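(* Let $(K,v)$ be a valued field. For every algebraic immediate approximation type $\mathbf A$ over $(K,v)$ with associated minimal polynomial $f(X)\in K[X]$ and every root $a$ of $f$, there exists an extension of $v$ from $K$ to $K(a)$ such that $(K(a)|K,v)$ is an immediate extension and $\mathrm{appr}_v(a,K)=\mathbf A$. If $(K(b),v)$ is another extension field of $(K,v)$ such that $\mathrm{appr}_v(b,K)=\mathbf A$, then any field isomorphism between $K(a)$ and $K(b)$ over $K$ sending $a$ to $b$ preserves the valuation.
   Context: Valuations are Krull valuations written additively; $vK$ is the value group, $Kv$ the residue field, and $\infty$ is larger than all values. Equivalent valuations are identified. An extension $(L|K,v)$ is immediate if the canonical embeddings $vK\hookrightarrow vL$ and $Kv\hookrightarrow Lv$ are onto. Balls: for $c\in K$, the closed ball of radius $\gamma\in vK\cup\{\infty\}$ is $B_\gamma(c,K)=\{a\in K\mid v(a-c)\ge\gamma\}$, and the open ball of radius $\gamma\in vK$ is $B^\circ_\gamma(c,K)=\{a\in K\mid v(a-c)>\gamma\}$. Balls are recorded together with their radius and their kind (open/closed). An approximation type $\mathbf A$ over $(K,v)$ is a (possibly empty) collection of closed and open balls in $(K,v)$, any two of which are comparable by inclusion, such that whenever $\mathbf A$ contains a (closed or open) ball with center $c$ and radius $\gamma$, it contains $B_\beta(c,K)$ and $B_\beta^\circ(c,K)$ for all $\beta\in vK$ with $\beta<\gamma$, and whenever it contains $B^\circ_\gamma(c,K)$ it contains $B_\gamma(c,K)$. Its support $\mathrm{supp}\,\mathbf A$ is the set of all $\gamma$ such that $\mathbf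 A$ contains a closed ball of radius $\gamma$; this ball is then unique and denoted $\mathbf A_\gamma$. $\mathbf A$ is immediate if it is nonempty and the intersection of all its balls is empty. An immediate $\mathbf A$ fixes the value of $f\in K[X]$ if there is $\delta\in\mathrm{supp}\,\mathbf A$ such that $vf(c)$ is constant for $c\in\mathbf A_\delta$; it is algebraic if there is some $f\in K[X]$ whose value it does not fix. In this case, an associated minimal polynomial for $\mathbf A$ is a monic polynomial $f\in K[X]$ of minimal degree among the polynomials whose value is not fixed by $\mathbf A$. For an extension $(L|K,v)$ of valued fields and $x\in L$, $\mathrm{appr}_v(x,K)$ is the approximation type over $(K,v)$ consisting of all nonempty sets $\{c\in K\mid v(x-c)\ge\gamma\}$, $\gamma\in vK\cup\{\infty\}$ (as closed balls of radius $\gamma$), and all nonempty sets $\{c\in K\mid v(x-c)>\gamma\}$, $\gamma\in vK$ (as open balls of radius $\gamma$). *)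

theory Defs
  imports "Subresultants.Resultant_Prelim"
begin

section \<open>Krull valuations\<close>

text \<open>An ordered abelian group together with an element \<open>Infty\<close> above all others.
  (The type \<open>extended\<close> of the library also has a least element.)\<close>

datatype 'g vinf = Fin 'g | Infty

instantiation vinf :: (linorder) linorder
begin

fun less_eq_vinf :: "'a vinf \<Rightarrow> 'a vinf \<Rightarrow> bool" where
  "less_eq_vinf x Infty \<longleftrightarrow> True"
| "less_eq_vinf (Fin x) (Fin y) \<longleftrightarrow> x \<le> y"
| "less_eq_vinf Infty (Fin y) \<longleftrightarrow> False"

definition less_vinf :: "'a vinf \<Rightarrow> 'a vinf \<Rightarrow> bool" where
  "less_vinf x y \<longleftrightarrow> x \<le> y \<and> \<not> y \<le> x"

instance
proof
  fix x y z :: "'a vinf"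
  show "x < y \<longleftrightarrow> x \<le> y \<and> \<not> y \<le> x" by (rule less_vinf_def)
  show "x \<le> x" by (cases x) auto
  show "x \<le> z" if "x \<le> y" "y \<le> z"
    using that by (cases x; cases y; cases z) auto
  show "x = y" if "x \<le> y" "y \<le> x"
    using that by (cases x; cases y) auto
  show "x \<le> y \<or> y \<le> x" by (cases x; cases y) auto
qed

end

lemma Fin_less_simps [simp]:
  "Fin x < Fin y \<longleftrightarrow> x < y" "Fin x < Infty" "\<not> Infty < z"
  by (auto simp: less_vinf_def)

instantiation vinf :: (comm_monoid_add) comm_monoid_add
begin

definition zero_vinf :: "'a vinf" where "zero_vinf = Fin 0"

fun plus_vinf :: "'a vinf \<Rightarrow> 'a vinf \<Rightarrow> 'a vinf" where
  "plus_vinf (Fin x) (Fin y) = Fin (x + y)"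
| "plus_vinf Infty y = Infty"
| "plus_vinf (Fin x) Infty = Infty"

instance
proof
  fix x y z :: "'a vinf"
  show "x + y + z = x + (y + z)" by (cases x; cases y; cases z) (auto simp: add.assoc)
  show "x + y = y + x" by (cases x; cases y) (auto simp: add.commute)
  show "0 + x = x" by (cases x) (auto simp: zero_vinf_def)
qed

end

text \<open>Extension fields of the form \<open>K(a)\<close> are subfields \<open>F\<close> of an ambient field type, so
  valuations are considered on a set \<open>F\<close>; values outside \<open>F\<close> are irrelevant. The value group
  need not be all of the type \<open>'g\<close>.\<close>

definition valuation_on :: "'a::field set \<Rightarrow> ('a \<Rightarrow> 'g::linordered_ab_group_add vinf) \<Rightarrow> bool" where
  "valuation_on F v \<longleftrightarrow>
     (\<forall>x\<in>F. v x = Infty \<longleftrightarrow> x = 0) \<and>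
     (\<forall>x\<in>F. \<forall>y\<in>F. v (x * y) = v x + v y) \<and>
     (\<forall>x\<in>F. \<forall>y\<in>F. min (v x) (v y) \<le> v (x + y))"

definition value_group :: "'a::field set \<Rightarrow> ('a \<Rightarrow> 'g::linordered_ab_group_add vinf) \<Rightarrow> 'g set" where
  "value_group F v = {\<gamma>. \<exists>x\<in>F. v x = Fin \<gamma>}"

definition valuation_ring :: "'a::field set \<Rightarrow> ('a \<Rightarrow> 'g::linordered_ab_group_add vinf) \<Rightarrow> 'a set" where
  "valuation_ring F v = {x\<in>F. 0 \<le> v x}"

definition valuation_ideal :: "'a::field set \<Rightarrow> ('a \<Rightarrow> 'g::linordered_ab_group_add vinf) \<Rightarrow> 'a set" where
  "valuation_ideal F v = {x\<in>F. 0 < v x}"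

text \<open>The underlying set of the residue field: the cosets of the valuation ideal in the
  valuation ring.\<close>

definition residue_field :: "'a::field set \<Rightarrow> ('a \<Rightarrow> 'g::linordered_ab_group_add vinf) \<Rightarrow> 'a set set" where
  "residue_field F v = {(+) x ` valuation_ideal F v | x. x \<in> valuation_ring F v}"

definition equivalent_valuations ::
  "'a::field set \<Rightarrow> ('a \<Rightarrow> 'g::linordered_ab_group_add vinf) \<Rightarrow> ('a \<Rightarrow> 'h::linordered_ab_group_add vinf) \<Rightarrow> bool" where
  "equivalent_valuations F v w \<longleftrightarrow>
     (\<exists>\<rho>. bij_betw \<rho> (value_group F v) (value_group F w) \<and>
          strict_mono_on (value_group F v) \<rho> \<and>
          (\<forall>\<gamma>\<in>value_group F v. \<forall>\<delta>\<in>value_group F v. \<rho> (\<gamma> + \<delta>) = \<rho> \<gamma> + \<rho> \<delta>) \<and>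
          (\<forall>x\<in>F. w x = map_vinf \<rho> (v x)))"

section \<open>Extensions\<close>

definition is_subfield :: "'a::field set \<Rightarrow> bool" where
  "is_subfield F \<longleftrightarrow> 1 \<in> F \<and> (\<forall>x\<in>F. \<forall>y\<in>F. x - y \<in> F \<and> x * y \<in> F) \<and> (\<forall>x\<in>F. inverse x \<in> F)"

text \<open>\<open>K(a)\<close>, where \<open>K\<close> is embedded by \<open>\<iota>\<close>\<close>

definition adjoin :: "('k::field \<Rightarrow> 'l::field) \<Rightarrow> 'l \<Rightarrow> 'l set" where
  "adjoin \<iota> a = \<Inter>{F. is_subfield F \<and> range \<iota> \<subseteq> F \<and> a \<in> F}"

definition field_iso_on :: "'l::field set \<Rightarrow> 'm::field set \<Rightarrow> ('l \<Rightarrow> 'm) \<Rightarrow> bool" where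
  "field_iso_on F G \<sigma> \<longleftrightarrow> bij_betw \<sigma> F G \<and>
     (\<forall>x\<in>F. \<forall>y\<in>F. \<sigma> (x + y) = \<sigma> x + \<sigma> y \<and> \<sigma> (x * y) = \<sigma> x * \<sigma> y)"

text \<open>\<open>(L|K,v)\<close> is an extension of valued fields, where \<open>w\<close> is the valuation on \<open>L\<close>. The
  map \<open>\<phi>\<close> is the canonical embedding of value groups; it matters only on the value group
  of \<open>v\<close>, where it is determined by \<open>v\<close>, \<open>w\<close> and \<open>\<iota>\<close> (and additive).\<close>

definition valued_extension ::
  "('k::field \<Rightarrow> 'g::linordered_ab_group_add vinf) \<Rightarrow> ('k \<Rightarrow> 'l::field) \<Rightarrow> ('g \<Rightarrow> 'h::linordered_ab_group_add) \<Rightarrow>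
   'l set \<Rightarrow> ('l \<Rightarrow> 'h vinf) \<Rightarrow> bool" where
  "valued_extension v \<iota> \<phi> L w \<longleftrightarrow>
     field_hom \<iota> \<and> is_subfield L \<and> range \<iota> \<subseteq> L \<and> valuation_on L w \<and>
     strict_mono_on (value_group UNIV v) \<phi> \<and>
     (\<forall>c. w (\<iota> c) = map_vinf \<phi> (v c))"

text \<open>The canonical embedding \<open>Kv \<rightarrow> Lv\<close>: the coset \<open>c + \<M>\<^sub>v\<close> is sent to \<open>\<iota> c + \<M>\<^sub>w\<close>.\<close>

definition residue_embedding ::
  "('k::field \<Rightarrow> 'l::field) \<Rightarrow> 'l set \<Rightarrow> ('l \<Rightarrow> 'h::linordered_ab_group_add vinf) \<Rightarrow> 'k set \<Rightarrow> 'l set" where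
  "residue_embedding \<iota> L w C = {\<iota> c + m | c m. c \<in> C \<and> m \<in> valuation_ideal L w}"

definition immediate_extension ::
  "('k::field \<Rightarrow> 'g::linordered_ab_group_add vinf) \<Rightarrow> ('k \<Rightarrow> 'l::field) \<Rightarrow> ('g \<Rightarrow> 'h::linordered_ab_group_add) \<Rightarrow>
   'l set \<Rightarrow> ('l \<Rightarrow> 'h vinf) \<Rightarrow> bool" where
  "immediate_extension v \<iota> \<phi> L w \<longleftrightarrow>
     valued_extension v \<iota> \<phi> L w \<and>
     \<phi> ` value_group UNIV v = value_group L w \<and>
     residue_embedding \<iota> L w ` residue_field UNIV v = residue_field L w"

section \<open>Approximation types\<close>

text \<open>Balls are recorded with their kind and radius, so that for instance a closed and an
  open ball with the same underlying set are different.\<close>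

datatype ('k, 'g) vball = Closed "'g vinf" "'k set" | Open 'g "'k set"

fun points :: "('k, 'g) vball \<Rightarrow> 'k set" where
  "points (Closed \<gamma> S) = S"
| "points (Open \<gamma> S) = S"

definition closed_ball :: "('k::field \<Rightarrow> 'g::linordered_ab_group_add vinf) \<Rightarrow> 'g vinf \<Rightarrow> 'k \<Rightarrow> ('k, 'g) vball" where
  "closed_ball v \<gamma> c = Closed \<gamma> {a. \<gamma> \<le> v (a - c)}"

definition open_ball :: "('k::field \<Rightarrow> 'g::linordered_ab_group_add vinf) \<Rightarrow> 'g \<Rightarrow> 'k \<Rightarrow> ('k, 'g) vball" where
  "open_ball v \<gamma> c = Open \<gamma> {a. Fin \<gamma> < v (a - c)}"

definition closed_radii :: "('k::field \<Rightarrow> 'g::linordered_ab_group_add vinf) \<Rightarrow> 'g vinf set" where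
  "closed_radii v = insert Infty (Fin ` value_group UNIV v)"

definition balls :: "('k::field \<Rightarrow> 'g::linordered_ab_group_add vinf) \<Rightarrow> ('k, 'g) vball set" where
  "balls v = {closed_ball v \<gamma> c | \<gamma> c. \<gamma> \<in> closed_radii v} \<union>
             {open_ball v \<gamma> c | \<gamma> c. \<gamma> \<in> value_group UNIV v}"

definition approximation_type ::
  "('k::field \<Rightarrow> 'g::linordered_ab_group_add vinf) \<Rightarrow> ('k, 'g) vball set \<Rightarrow> bool" where
  "approximation_type v A \<longleftrightarrow>
     A \<subseteq> balls v \<and>
     (\<forall>B\<in>A. \<forall>B'\<in>A. points B \<subseteq> points B' \<or> points B' \<subseteq> points B) \<and>
     (\<forall>\<gamma> c. closed_ball v \<gamma> c \<in> A \<longrightarrow>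
        (\<forall>\<beta>\<in>value_group UNIV v. Fin \<beta> < \<gamma> \<longrightarrow>
           closed_ball v (Fin \<beta>) c \<in> A \<and> open_ball v \<beta> c \<in> A)) \<and>
     (\<forall>\<gamma> c. open_ball v \<gamma> c \<in> A \<longrightarrow>
        (\<forall>\<beta>\<in>value_group UNIV v. \<beta> < \<gamma> \<longrightarrow>
           closed_ball v (Fin \<beta>) c \<in> A \<and> open_ball v \<beta> c \<in> A)) \<and>
     (\<forall>\<gamma> c. open_ball v \<gamma> c \<in> A \<longrightarrow> closed_ball v (Fin \<gamma>) c \<in> A)"

definition supp :: "('k, 'g) vball set \<Rightarrow> 'g vinf set" where
  "supp A = {\<gamma>. \<exists>S. Closed \<gamma> S \<in> A}"

text \<open>\<open>A\<^sub>\<gamma>\<close>; well defined for \<open>\<gamma> \<in> supp A\<close> by the lemma that follows.\<close>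

definition ball_at :: "('k, 'g) vball set \<Rightarrow> 'g vinf \<Rightarrow> 'k set" where
  "ball_at A \<gamma> = (THE S. Closed \<gamma> S \<in> A)"

lemma valuation_on_UNIV_minus:
  assumes "valuation_on UNIV v"
  shows "v (- x) = v x"
proof -
  have m: "v (x * y) = v x + v y" for x y using assms by (simp add: valuation_on_def)
  have "v 1 \<noteq> Infty" "v (- 1) \<noteq> Infty" using assms by (auto simp: valuation_on_def)
  then obtain r s where rs: "v 1 = Fin r" "v (- 1) = Fin s" by (meson vinf.exhaust)
  have "Fin r = Fin r + Fin r" "Fin r = Fin s + Fin s"
    using m[of 1 1] m[of "- 1" "- 1"] rs by simp_all
  then have "r = r + r" "r = s + s" by simp_all
  then have "r = 0" "s + s = 0" by (metis add_cancel_left_right)+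
  then have "v (- 1) = 0" using rs by (simp add: zero_vinf_def)
  then show ?thesis using m[of "- 1" x] by simp
qed

lemma ball_at_eq:
  fixes v :: "'k::field \<Rightarrow> 'g::linordered_ab_group_add vinf"
  assumes v: "valuation_on UNIV v" and A: "approximation_type v A" and S: "Closed \<gamma> S \<in> A"
  shows "ball_at A \<gamma> = S"
proof -
  have tri: "\<gamma> \<le> v (x + y)" if "\<gamma> \<le> v x" "\<gamma> \<le> v y" for x y
  proof -
    have "min (v x) (v y) \<le> v (x + y)" using v by (simp add: valuation_on_def)
    then show ?thesis using that by (meson min.boundedI order_trans)
  qed
  have form: "\<exists>c. T = {a. \<gamma> \<le> v (a - c)}" if "Closed \<gamma> T \<in> A" for T
    using A that by (auto simp: approximation_type_def balls_def closed_ball_def open_ball_def)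
  have v0: "v 0 = Infty" using v by (simp add: valuation_on_def)
  have recentre: "{a. \<gamma> \<le> v (a - c)} = {a. \<gamma> \<le> v (a - d)}" if "\<gamma> \<le> v (d - c)" for c d
  proof -
    have "\<gamma> \<le> v (c - d)" using that valuation_on_UNIV_minus[OF v, of "d - c"] by simp
    then show ?thesis
      using that tri[of "x - d" "d - c" for x] tri[of "x - c" "c - d" for x] by auto
  qed
  have "T = S" if T: "Closed \<gamma> T \<in> A" for T
  proof -
    obtain c d where cd: "S = {a. \<gamma> \<le> v (a - c)}" "T = {a. \<gamma> \<le> v (a - d)}"
      using form[OF S] form[OF T] by blast
    have "S \<subseteq> T \<or> T \<subseteq> S"
    proof -
      have "\<forall>B\<in>A. \<forall>B'\<in>A. points B \<subseteq> points B' \<or> points B' \<subseteq> points B"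
        using A unfolding approximation_type_def by (elim conjE)
      from bspec[OF bspec[OF this S] T] show ?thesis by simp
    qed
    moreover have "c \<in> S" "d \<in> T" using cd v0 by simp_all
    ultimately have "c \<in> T \<or> d \<in> S" by blast
    then have "\<gamma> \<le> v (d - c) \<or> \<gamma> \<le> v (c - d)" using cd by blast
    then show ?thesis
    proof
      assume "\<gamma> \<le> v (d - c)"
      from recentre[OF this] show ?thesis by (simp only: cd)
    next
      assume "\<gamma> \<le> v (c - d)"
      from recentre[OF this] show ?thesis by (simp only: cd)
    qed
  qed
  with S show ?thesis unfolding ball_at_def by (rule the_equality)
qed

definition immediate_type ::
  "('k::field \<Rightarrow> 'g::linordered_ab_group_add vinf) \<Rightarrow> ('k, 'g) vball set \<Rightarrow> bool" where
  "immediate_type v A \<longleftrightarrow> approximation_type v A \<and> A \<noteq> {} \<and> (\<Inter>B\<in>A. points B) = {}"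

definition fixes_value ::
  "('k::field \<Rightarrow> 'g::linordered_ab_group_add vinf) \<Rightarrow> ('k, 'g) vball set \<Rightarrow> 'k poly \<Rightarrow> bool" where
  "fixes_value v A f \<longleftrightarrow> (\<exists>\<delta>\<in>supp A. \<exists>\<alpha>. \<forall>c\<in>ball_at A \<delta>. v (poly f c) = \<alpha>)"

definition algebraic_type ::
  "('k::field \<Rightarrow> 'g::linordered_ab_group_add vinf) \<Rightarrow> ('k, 'g) vball set \<Rightarrow> bool" where
  "algebraic_type v A \<longleftrightarrow> (\<exists>f. \<not> fixes_value v A f)"

definition associated_minimal_polynomial ::
  "('k::field \<Rightarrow> 'g::linordered_ab_group_add vinf) \<Rightarrow> ('k, 'g) vball set \<Rightarrow> 'k poly \<Rightarrow> bool" where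
  "associated_minimal_polynomial v A f \<longleftrightarrow>
     lead_coeff f = 1 \<and> \<not> fixes_value v A f \<and>
     (\<forall>g. \<not> fixes_value v A g \<longrightarrow> degree f \<le> degree g)"

text \<open>\<open>appr\<^sub>w(x,K)\<close>, for a valued extension with embeddings \<open>\<iota>\<close> and \<open>\<phi>\<close> as above.\<close>

definition appr ::
  "('k::field \<Rightarrow> 'g::linordered_ab_group_add vinf) \<Rightarrow> ('k \<Rightarrow> 'l::field) \<Rightarrow> ('g \<Rightarrow> 'h::linordered_ab_group_add) \<Rightarrow>
   ('l \<Rightarrow> 'h vinf) \<Rightarrow> 'l \<Rightarrow> ('k, 'g) vball set" where
  "appr v \<iota> \<phi> w x =
     {Closed \<gamma> S | \<gamma> S. \<gamma> \<in> closed_radii v \<and> S = {c. map_vinf \<phi> \<gamma> \<le> w (x - \<iota> c)} \<and> S \<noteq> {}} \<union>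
     {Open \<gamma> S | \<gamma> S. \<gamma> \<in> value_group UNIV v \<and> S = {c. Fin (\<phi> \<gamma>) < w (x - \<iota> c)} \<and> S \<noteq> {}}"

end

theory Submission
  imports Defs
begin

text \<open>The value that a polynomial of degree smaller than \<open>deg f\<close> takes at a root \<open>a\<close> of the
  associated minimal polynomial \<open>f\<close> has to be the value that it takes at all points of small balls of
  the approximation type, and this prescription works.

  Every element of \<open>K(a)\<close> is \<open>g(a)\<close> for exactly one \<open>g\<close> with \<open>deg g < deg f\<close>, since products of
  polynomials with fixed value have a fixed value, which makes \<open>f\<close> irreducible (\<open>no_proper_factor\<close>).
  By minimality \<open>A\<close> fixes the value of \<open>g\<close>, and \<open>w(g(a))\<close> is defined as this fixed value. The
  ultrametric inequality is inherited from \<open>v\<close>. For multiplicativity, reduce \<open>g h = q f + r\<close> modulo \<open>f\<close>.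
  Were the fixed values of \<open>g h\<close> and \<open>r\<close> different, then \<open>q f\<close> would have a fixed value too, and so
  would \<open>f\<close> (\<open>eventual_value_mult_mod\<close>). Linear polynomials have degree smaller than \<open>deg f\<close>, hence
  \<open>w(a - c)\<close> is the common value of \<open>x - c\<close> for \<open>x\<close> in small balls. These values determine \<open>A\<close>, and so
  \<open>a\<close> has approximation type \<open>A\<close>. No new values arise in \<open>K(a)\<close>.

  That there are no new residues, and that the extension is unique, both follow from one lemma
  in the style of Kaplansky (\<open>eval_difference_not_eventually_constant\<close>): if \<open>x\<close> has approximation type
  \<open>A\<close> and \<open>deg g < deg f\<close>, then \<open>w(g(x) - g(c))\<close> cannot have a constant finite value for all \<open>c\<close> in a
  small ball, because by the Taylor expansion it eventually increases strictly with \<open>w(x - c)\<close>. If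
  \<open>w(g(a)) = 0\<close> and no \<open>g(c)\<close> had the residue of \<open>g(a)\<close>, this constant value would be \<open>0\<close>. If \<open>w\<close> is any
  extension with the right approximation type and \<open>w(g(a))\<close> differed from the fixed value of \<open>g\<close>,
  the constant would be the smaller of these two values. So \<open>A\<close> determines \<open>w(g(a))\<close> for all \<open>g\<close>
  (\<open>val_eval_via\<close>), which gives the second part.\<close>

section \<open>Valuations on subfields\<close>

text \<open>The value of \<open>x ^ n\<close> is this multiple of the value of \<open>x\<close>.\<close>

primrec nmult :: "nat \<Rightarrow> 'g::ab_group_add \<Rightarrow> 'g" where
  "nmult 0 g = 0"
| "nmult (Suc n) g = g + nmult n g"

lemma nmult_add: "nmult (m + n) g = nmult m g + nmult n g"
  by (induction m) (simp_all add: add.assoc)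

lemma nmult_strict_mono:
  fixes g h :: "'g::linordered_ab_group_add"
  assumes "g < h" "0 < n"
  shows "nmult n g < nmult n h"
  using assms(2) by (induction rule: nat_induct_non_zero) (use assms(1) in \<open>auto intro: add_strict_mono\<close>)

locale valued_subfield =
  fixes F :: "'a::field set" and w :: "'a \<Rightarrow> 'h::linordered_ab_group_add vinf"
  assumes subfield: "is_subfield F" and valuation: "valuation_on F w"
begin

lemma one_mem: "1 \<in> F" and minus_mem: "x \<in> F \<Longrightarrow> y \<in> F \<Longrightarrow> x - y \<in> F"
  and mult_mem: "x \<in> F \<Longrightarrow> y \<in> F \<Longrightarrow> x * y \<in> F"
  using subfield by (auto simp: is_subfield_def)

lemma zero_mem: "0 \<in> F"
  using minus_mem[OF one_mem one_mem] by simp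

lemma add_mem: "x \<in> F \<Longrightarrow> y \<in> F \<Longrightarrow> x + y \<in> F"
  using minus_mem[of x "0 - y"] minus_mem[of 0 y] zero_mem by simp

lemma power_mem: "x \<in> F \<Longrightarrow> x ^ n \<in> F"
  by (induction n) (auto simp: one_mem mult_mem)

lemma sum_mem: "(\<And>i. i \<in> I \<Longrightarrow> y i \<in> F) \<Longrightarrow> sum y I \<in> F"
  by (induction I rule: infinite_finite_induct) (auto simp: zero_mem add_mem)

lemma poly_mem: "(\<And>i. coeff p i \<in> F) \<Longrightarrow> x \<in> F \<Longrightarrow> poly p x \<in> F"
  by (auto simp: poly_altdef intro!: sum_mem mult_mem power_mem)

lemma val_eq_Infty: "x \<in> F \<Longrightarrow> w x = Infty \<longleftrightarrow> x = 0"
  and val_mult: "x \<in> F \<Longrightarrow> y \<in> F \<Longrightarrow> w (x * y) = w x + w y"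
  and val_add: "x \<in> F \<Longrightarrow> y \<in> F \<Longrightarrow> min (w x) (w y) \<le> w (x + y)"
  using valuation by (auto simp: valuation_on_def)

lemma val_zero: "w 0 = Infty"
  using val_eq_Infty zero_mem by blast

lemma val_square_one: "x \<in> F \<Longrightarrow> x * x = 1 \<Longrightarrow> w x = 0"
proof -
  have one: "w 1 = 0"
  proof -
    obtain r where "w 1 = Fin r" using val_eq_Infty[OF one_mem] by (cases "w 1") auto
    then show ?thesis using val_mult[OF one_mem one_mem] by (auto simp: zero_vinf_def)
  qed
  assume x: "x \<in> F" "x * x = 1"
  then obtain r where r: "w x = Fin r" using val_eq_Infty[of x] by (cases "w x") auto
  then have "r + r = 0" using val_mult[OF x(1) x(1)] x one by (simp add: zero_vinf_def)
  then show ?thesis using r by (simp add: zero_vinf_def)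
qed

lemma val_one: "w 1 = 0"
  using val_square_one one_mem by simp

lemma val_minus: "x \<in> F \<Longrightarrow> w (- x) = w x"
  using val_mult[of "- 1" x] val_square_one[of "- 1"] minus_mem[OF zero_mem one_mem] by simp

lemma val_diff: "x \<in> F \<Longrightarrow> y \<in> F \<Longrightarrow> min (w x) (w y) \<le> w (x - y)"
  using val_add[of x "- y"] val_minus[of y] minus_mem[OF zero_mem, of y] by simp

lemma val_minus_commute: "x \<in> F \<Longrightarrow> y \<in> F \<Longrightarrow> w (x - y) = w (y - x)"
  using val_minus[of "x - y"] minus_mem[of x y] by simp

lemma val_power: "x \<in> F \<Longrightarrow> w x = Fin e \<Longrightarrow> w (x ^ n) = Fin (nmult n e)"
  by (induction n) (auto simp: val_one zero_vinf_def val_mult power_mem)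

lemma val_add_dominant:
  assumes "x \<in> F" "y \<in> F" "w x < w y"
  shows "w (x + y) = w x"
proof -
  have "w x \<le> w (x + y)" using val_add[of x y] assms by (simp add: min_def split: if_splits)
  moreover have "min (w (x + y)) (w y) \<le> w x"
    using val_diff[of "x + y" y] add_mem assms by simp
  ultimately show ?thesis using assms(3) by (auto simp: min_def split: if_splits)
qed

lemma val_diff_unequal:
  assumes "x \<in> F" "y \<in> F" "w x \<noteq> w y"
  shows "w (x - y) = min (w x) (w y)"
proof -
  have y': "- y \<in> F" using minus_mem[OF zero_mem assms(2)] by simp
  show ?thesis
    using val_add_dominant[of x "- y"] val_add_dominant[of "- y" x] assms y' val_minus[of y]
    by (cases "w x < w y") (auto simp: min_def)
qed

text \<open>The bound \<open>m\<close> is finite because the empty sum has the value \<open>Infty\<close>, which does not exceed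
  \<open>Infty\<close>.\<close>

lemma val_sum_greater:
  assumes "finite I" "m \<noteq> Infty" "\<And>i. i \<in> I \<Longrightarrow> y i \<in> F" "\<And>i. i \<in> I \<Longrightarrow> m < w (y i)"
  shows "m < w (sum y I)"
  using assms
proof (induction I)
  case empty
  then show ?case by (cases m) (auto simp: val_zero)
next
  case (insert i I)
  have "min (w (y i)) (w (sum y I)) \<le> w (y i + sum y I)"
    using insert by (intro val_add sum_mem) auto
  moreover have "m < min (w (y i)) (w (sum y I))" using insert by simp
  ultimately have "m < w (y i + sum y I)" by order
  then show ?case using insert by simp
qed

text \<open>A summand of least value dominates the sum of all the others, whose value is strictly larger as
  no two summands have the same value.\<close>

lemma val_sum_distinct:
  assumes "finite I" "I \<noteq> {}" "\<And>i. i \<in> I \<Longrightarrow> y i \<in> F" "\<And>i. i \<in> I \<Longrightarrow> w (y i) \<noteq> Infty"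
    and inj: "inj_on (\<lambda>i. w (y i)) I"
  obtains i where "i \<in> I" "w (sum y I) = w (y i)" "\<And>j. j \<in> I \<Longrightarrow> w (y i) \<le> w (y j)"
proof -
  obtain i where i: "i \<in> I" "\<And>j. j \<in> I \<Longrightarrow> w (y i) \<le> w (y j)"
    using ex_min_if_finite[of "(\<lambda>i. w (y i)) ` I"] assms(1,2) by (auto simp: not_less)
  have "w (y i) < w (sum y (I - {i}))"
  proof (rule val_sum_greater)
    fix j assume j: "j \<in> I - {i}"
    then have "w (y i) \<noteq> w (y j)" using inj i(1) by (auto simp: inj_on_def)
    then show "w (y i) < w (y j)" using i(2)[of j] j by (simp add: order.strict_iff_order)
  qed (use assms i in auto)
  then have "w (y i + sum y (I - {i})) = w (y i)"
    using assms i by (intro val_add_dominant sum_mem) auto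
  then have "w (sum y I) = w (y i)" using assms(1) i(1) by (simp add: sum.remove)
  with i show ?thesis using that by blast
qed

end

section \<open>Taylor expansion\<close>

text \<open>The coefficient of \<open>Y\<^sup>i\<close> in \<open>g(c + Y)\<close> is a polynomial in \<open>c\<close>, the \<open>i\<close>-th Hasse derivative of
  \<open>g\<close>. Only the bound on its degree matters below: if all polynomials of degree up to that of \<open>g\<close>
  have a fixed value, then so have all the coefficients of the Taylor expansion of \<open>g\<close>.\<close>

lemma taylor_coefficient:
  fixes g :: "'a::comm_ring_1 poly"
  shows "\<exists>d. degree d \<le> degree g \<and> (\<forall>c. coeff (g \<circ>\<^sub>p [:c, 1:]) i = poly d c)"
proof (induction g arbitrary: i)
  case 0
  show ?case by (intro exI[of _ 0]) simp
next
  case (pCons a p)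
  show ?case
  proof (cases "p = 0")
    case True
    then show ?thesis by (intro exI[of _ "[:coeff [:a:] i:]"]) (simp add: pcompose_pCons)
  next
    case False
    obtain d where d: "\<And>i. degree (d i) \<le> degree p"
      "\<And>i c. coeff (p \<circ>\<^sub>p [:c, 1:]) i = poly (d i) c"
      using pCons.IH by metis
    define e where "e = (if i = 0 then [:a:] else d (i - 1)) + pCons 0 (d i)"
    have "degree e \<le> Suc (degree p)"
      unfolding e_def
      by (intro degree_add_le) (use d(1)[of i] d(1)[of "i - 1"] in auto)
    moreover have "coeff (pCons a p \<circ>\<^sub>p [:c, 1:]) i = poly e c" for c
      unfolding e_def
      by (cases i) (simp_all add: pcompose_pCons d(2)[symmetric] coeff_pCons)
    ultimately show ?thesis using False by (intro exI[of _ e]) simp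
  qed
qed

section \<open>Immediate approximation types as filters\<close>

text \<open>The filter of those sets which contain some ball of the type. Its advantage over the
  balls themselves is that finitely many conditions holding from some ball on can be combined
  without naming that ball.\<close>

definition tail :: "('k, 'g) vball set \<Rightarrow> 'k filter" where
  "tail A = (INF \<gamma>\<in>supp A. principal (ball_at A \<gamma>))"

definition eventual_value ::
  "('k::field \<Rightarrow> 'g::linordered_ab_group_add vinf) \<Rightarrow> ('k, 'g) vball set \<Rightarrow> 'k poly \<Rightarrow> 'g vinf" where
  "eventual_value v A g = (THE \<alpha>. \<forall>\<^sub>F c in tail A. v (poly g c) = \<alpha>)"

text \<open>The value that \<open>x - c\<close> takes for all \<open>x\<close> in small balls of \<open>A\<close>. In an extension
  it is the value of \<open>a - c\<close> for every \<open>a\<close> with approximation type \<open>A\<close>.\<close>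

abbreviation dist_from ::
  "('k::field \<Rightarrow> 'g::linordered_ab_group_add vinf) \<Rightarrow> ('k, 'g) vball set \<Rightarrow> 'k \<Rightarrow> 'g vinf" where
  "dist_from v A c \<equiv> eventual_value v A [:- c, 1:]"

lemma is_subfield_UNIV: "is_subfield UNIV"
  by (simp add: is_subfield_def)

locale immediate_approximation =
  fixes v :: "'k::field \<Rightarrow> 'g::linordered_ab_group_add vinf" and A :: "('k, 'g) vball set"
  assumes val_v: "valuation_on UNIV v" and immediate: "immediate_type v A"
begin

sublocale K: valued_subfield UNIV v
  by unfold_locales (rule is_subfield_UNIV, rule val_v)

lemma appr_type: "approximation_type v A" and nonempty: "A \<noteq> {}"
  and no_common_point: "\<exists>B\<in>A. c \<notin> points B"
  using immediate by (auto simp: immediate_type_def)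

lemma sub_balls: "A \<subseteq> balls v"
  and comparable: "\<lbrakk>B \<in> A; B' \<in> A\<rbrakk> \<Longrightarrow> points B \<subseteq> points B' \<or> points B' \<subseteq> points B"
  and closed_below: "\<lbrakk>closed_ball v \<gamma> c \<in> A; \<beta> \<in> value_group UNIV v; Fin \<beta> < \<gamma>\<rbrakk> \<Longrightarrow>
    closed_ball v (Fin \<beta>) c \<in> A \<and> open_ball v \<beta> c \<in> A"
  and closed_of_open: "open_ball v \<beta> c \<in> A \<Longrightarrow> closed_ball v (Fin \<beta>) c \<in> A"
  using appr_type unfolding approximation_type_def by blast+

lemma ball_cases:
  assumes "B \<in> A"
  obtains (closed) \<gamma> c where "B = closed_ball v \<gamma> c" "\<gamma> \<in> closed_radii v"
  | (opened) \<gamma> c where "B = open_ball v \<gamma> c" "\<gamma> \<in> value_group UNIV v"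
  using assms sub_balls unfolding balls_def by blast

lemma v_tri: "\<gamma> \<le> v (x - y) \<Longrightarrow> \<gamma> \<le> v (y - z) \<Longrightarrow> \<gamma> \<le> v (x - z)"
  using K.val_add[of "x - y" "y - z"] by (simp add: min_def split: if_splits)

lemma v_tri_less: "\<gamma> < v (x - y) \<Longrightarrow> \<gamma> < v (y - z) \<Longrightarrow> \<gamma> < v (x - z)"
  using K.val_add[of "x - y" "y - z"] by (auto simp add: min_def split: if_splits)

lemma v_commute: "v (x - y) = v (y - x)"
  by (rule K.val_minus_commute) simp_all

lemma v_self: "\<gamma> \<le> v (x - x)"
  by (simp add: K.val_zero)

lemma center_mem: "c \<in> points (closed_ball v \<gamma> c)" "c \<in> points (open_ball v \<beta> c)"
  by (simp_all add: closed_ball_def open_ball_def K.val_zero)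

lemma supp_iff: "\<gamma> \<in> supp A \<longleftrightarrow> (\<exists>c. closed_ball v \<gamma> c \<in> A)"
proof
  assume "\<gamma> \<in> supp A"
  then obtain S where S: "Closed \<gamma> S \<in> A" by (auto simp: supp_def)
  then show "\<exists>c. closed_ball v \<gamma> c \<in> A"
    by (cases rule: ball_cases) (use S in \<open>auto simp: closed_ball_def open_ball_def\<close>)
qed (auto simp: supp_def closed_ball_def)

lemma ball_at_closed_ball: "closed_ball v \<gamma> c \<in> A \<Longrightarrow> ball_at A \<gamma> = {x. \<gamma> \<le> v (x - c)}"
  by (rule ball_at_eq[OF val_v appr_type]) (simp add: closed_ball_def)

lemma ball_at_nonempty: "\<gamma> \<in> supp A \<Longrightarrow> \<exists>c. c \<in> ball_at A \<gamma>"
  unfolding supp_iff using ball_at_closed_ball v_self by blast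

lemma recenter:
  assumes "\<gamma> \<in> supp A" "c \<in> ball_at A \<gamma>"
  shows "closed_ball v \<gamma> c \<in> A" and "ball_at A \<gamma> = {x. \<gamma> \<le> v (x - c)}"
proof -
  obtain d where d: "closed_ball v \<gamma> d \<in> A" using assms(1) supp_iff by blast
  have cd: "\<gamma> \<le> v (c - d)" using assms(2) ball_at_closed_ball[OF d] by simp
  have "{x. \<gamma> \<le> v (x - c)} = {x. \<gamma> \<le> v (x - d)}"
    using v_tri[OF _ cd] v_tri[of \<gamma> _ d c] cd v_commute[of c d] by auto
  then have "closed_ball v \<gamma> c = closed_ball v \<gamma> d" by (simp add: closed_ball_def)
  with d show *: "closed_ball v \<gamma> c \<in> A" by simp
  show "ball_at A \<gamma> = {x. \<gamma> \<le> v (x - c)}" by (rule ball_at_closed_ball[OF *])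
qed

lemma supp_value_group:
  assumes "\<gamma> \<in> supp A"
  shows "\<gamma> \<in> Fin ` value_group UNIV v"
proof -
  obtain c where c: "closed_ball v \<gamma> c \<in> A" using assms supp_iff by blast
  from c have rad: "\<gamma> \<in> closed_radii v"
    by (cases rule: ball_cases) (auto simp: closed_ball_def open_ball_def)
  have "\<gamma> \<noteq> Infty"
  proof
    assume "\<gamma> = Infty"
    moreover have "Infty \<le> v (x - c) \<longleftrightarrow> x = c" for x
      using K.val_eq_Infty[of "x - c"] by (cases "v (x - c)") auto
    ultimately have "points (closed_ball v \<gamma> c) = {c}"
      by (simp add: closed_ball_def)
    moreover obtain B where B: "B \<in> A" "c \<notin> points B" using no_common_point by blast
    moreover have "points B \<noteq> {}"
      using B(1) by (cases rule: ball_cases) (use center_mem in blast)+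
    ultimately show False using comparable[OF c B(1)] by auto
  qed
  then show ?thesis using rad by (auto simp: closed_radii_def)
qed

lemma supp_below:
  assumes "\<gamma> \<in> supp A" "e \<in> value_group UNIV v" "Fin e < \<gamma>"
  shows "Fin e \<in> supp A" and "c \<in> ball_at A \<gamma> \<Longrightarrow> open_ball v e c \<in> A"
  using assms closed_below recenter(1) ball_at_nonempty supp_iff by blast+

lemma ball_at_antimono:
  assumes "\<gamma> \<in> supp A" "\<delta> \<in> supp A" "\<gamma> \<le> \<delta>"
  shows "ball_at A \<delta> \<subseteq> ball_at A \<gamma>"
proof (cases "\<gamma> = \<delta>")
  case False
  obtain c where c: "closed_ball v \<delta> c \<in> A" using assms supp_iff by blast
  obtain e where e: "e \<in> value_group UNIV v" "\<gamma> = Fin e" using supp_value_group assms by blast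
  have "closed_ball v \<gamma> c \<in> A" using closed_below[OF c e(1)] e(2) False assms(3) by auto
  then show ?thesis using ball_at_closed_ball c assms(3) by auto
qed simp

lemma open_balls_meet:
  assumes "open_ball v e c \<in> A" "open_ball v e d \<in> A"
  shows "Fin e < v (d - c)"
proof -
  have "d \<in> points (open_ball v e c) \<or> c \<in> points (open_ball v e d)"
    using comparable[OF assms] center_mem(2) by blast
  then show ?thesis by (auto simp: open_ball_def v_commute[of c d])
qed

text \<open>A largest radius in the support would leave a point in all the balls: the center of the open
  ball of that radius, if there is one in \<open>A\<close>, and otherwise any point of the closed ball.\<close>

lemma supp_no_max:
  assumes "\<gamma> \<in> supp A"
  shows "\<exists>\<delta>\<in>supp A. \<gamma> < \<delta>"
proof (rule ccontr)
  assume "\<not> ?thesis"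
  then have max: "\<delta> \<le> \<gamma>" if "\<delta> \<in> supp A" for \<delta> using that not_le by blast
  obtain e where e: "\<gamma> = Fin e" "e \<in> value_group UNIV v" using supp_value_group[OF assms] by blast
  obtain d where d: "closed_ball v \<gamma> d \<in> A"
    and d': "open_ball v e c \<in> A \<Longrightarrow> open_ball v e d \<in> A" for c
    using closed_of_open assms supp_iff e by metis
  have "d \<in> points B" if "B \<in> A" for B
    using that
  proof (cases rule: ball_cases)
    case (closed \<delta> c)
    then have "\<delta> \<in> supp A" using that supp_iff by blast
    then have "d \<in> ball_at A \<delta>"
      using ball_at_antimono[OF _ assms max] ball_at_closed_ball[OF d] v_self by blast
    then show ?thesis using ball_at_closed_ball[of \<delta> c] closed that by (simp add: closed_ball_def)
  next
    case (opened \<beta> c)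
    then have "Fin \<beta> \<in> supp A" using that closed_of_open supp_iff by blast
    then have "\<beta> \<le> e" using max e by fastforce
    then have "open_ball v \<beta> d \<in> A"
      using closed_below[OF d opened(2)] d' opened that e by (cases "\<beta> = e") auto
    then have "Fin \<beta> < v (d - c)" using open_balls_meet opened that by blast
    then show ?thesis using opened by (simp add: open_ball_def)
  qed
  then show False using no_common_point by blast
qed

lemma supp_nonempty: "supp A \<noteq> {}"
proof -
  obtain B where "B \<in> A" using nonempty by blast
  then show ?thesis by (cases rule: ball_cases) (use \<open>B \<in> A\<close> closed_of_open supp_iff in blast)+
qed

text \<open>Every open ball of \<open>A\<close> contains a closed ball of \<open>A\<close> of larger radius, since the support
  has no maximum. Hence the closed balls alone already have empty intersection.\<close>

lemma outside_some_ball: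
  "\<exists>\<gamma>\<in>supp A. c \<notin> ball_at A \<gamma>"
proof (rule ccontr)
  assume "\<not> ?thesis"
  then have all: "c \<in> ball_at A \<gamma>" if "\<gamma> \<in> supp A" for \<gamma> using that by blast
  have "c \<in> points B" if "B \<in> A" for B
    using that
  proof (cases rule: ball_cases)
    case (closed \<gamma> d)
    then show ?thesis using all[of \<gamma>] ball_at_closed_ball[of \<gamma> d] that supp_iff
      by (auto simp: closed_ball_def)
  next
    case (opened e d)
    then have "Fin e \<in> supp A" using that closed_of_open supp_iff by blast
    then obtain \<gamma> where "\<gamma> \<in> supp A" "Fin e < \<gamma>" using supp_no_max by blast
    then have "open_ball v e c \<in> A" using supp_below(2) opened(2) all by blast
    then show ?thesis using open_balls_meet[of e d c] opened that by (simp add: open_ball_def)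
  qed
  then show False using no_common_point by blast
qed

lemma eventually_tail: "eventually P (tail A) \<longleftrightarrow> (\<exists>\<gamma>\<in>supp A. \<forall>c\<in>ball_at A \<gamma>. P c)"
  unfolding tail_def
proof (subst eventually_INF_base)
  fix \<gamma> \<delta> assume *: "\<gamma> \<in> supp A" "\<delta> \<in> supp A"
  then have "max \<gamma> \<delta> \<in> supp A" by (simp add: max_def)
  with * show "\<exists>\<epsilon>\<in>supp A. principal (ball_at A \<epsilon>) \<le> inf (principal (ball_at A \<gamma>)) (principal (ball_at A \<delta>))"
    by (intro bexI[of _ "max \<gamma> \<delta>"]) (auto simp: subset_iff dest: ball_at_antimono[THEN subsetD, rotated -1])
qed (simp_all add: supp_nonempty eventually_principal)

lemma tail_nonbot: "tail A \<noteq> bot"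
  unfolding trivial_limit_def eventually_tail using ball_at_nonempty by blast

lemma eventually_in_ball: "\<gamma> \<in> supp A \<Longrightarrow> \<forall>\<^sub>F c in tail A. c \<in> ball_at A \<gamma>"
  using eventually_tail by blast

lemma fixes_value_iff: "fixes_value v A g \<longleftrightarrow> (\<exists>\<alpha>. \<forall>\<^sub>F c in tail A. v (poly g c) = \<alpha>)"
  unfolding fixes_value_def eventually_tail by blast

lemma eventual_value_eq:
  assumes "\<forall>\<^sub>F c in tail A. v (poly g c) = \<alpha>"
  shows "eventual_value v A g = \<alpha>"
  unfolding eventual_value_def
proof (rule the_equality)
  fix \<beta> assume "\<forall>\<^sub>F c in tail A. v (poly g c) = \<beta>"
  with assms have "\<forall>\<^sub>F c in tail A. \<beta> = \<alpha>" by eventually_elim simp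
  then show "\<beta> = \<alpha>" using tail_nonbot by simp
qed (rule assms)

lemma eventually_eventual_value:
  "fixes_value v A g \<Longrightarrow> \<forall>\<^sub>F c in tail A. v (poly g c) = eventual_value v A g"
  using eventual_value_eq fixes_value_iff by blast

text \<open>Seen from a point outside a ball, all points of the ball have the same distance.\<close>

lemma dist_outside_ball:
  assumes "\<gamma> \<in> supp A" "c \<notin> ball_at A \<gamma>" "x \<in> ball_at A \<gamma>"
  shows "v (x - c) = dist_from v A c" and "dist_from v A c < \<gamma>"
proof -
  have xc: "v (x - c) < \<gamma>"
    using assms(2) recenter(2)[OF assms(1,3)] by (simp add: v_commute[of c] not_le)
  have "v (y - c) = v (x - c)" if "y \<in> ball_at A \<gamma>" for y
  proof -
    have "\<gamma> \<le> v (y - x)" using that recenter(2)[OF assms(1,3)] by simp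
    then show ?thesis using K.val_add_dominant[of "x - c" "y - x"] xc by simp
  qed
  then have "\<forall>\<^sub>F y in tail A. v (poly [:- c, 1:] y) = v (x - c)"
    using eventually_tail assms(1) by auto
  then show "v (x - c) = dist_from v A c" using eventual_value_eq by simp
  then show "dist_from v A c < \<gamma>" using xc by simp
qed

lemma eventually_dist: "\<forall>\<^sub>F x in tail A. v (x - c) = dist_from v A c"
proof -
  obtain \<gamma> where "\<gamma> \<in> supp A" "c \<notin> ball_at A \<gamma>" using outside_some_ball by blast
  then show ?thesis using dist_outside_ball(1) eventually_tail by blast
qed

lemma fixes_linear: "fixes_value v A [:- c, 1:]"
  using eventually_dist[of c] fixes_value_iff by auto

lemma mem_ball_at_iff:
  assumes "\<gamma> \<in> supp A"
  shows "c \<in> ball_at A \<gamma> \<longleftrightarrow> \<gamma> \<le> dist_from v A c"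
proof
  assume c: "c \<in> ball_at A \<gamma>"
  have "\<forall>\<^sub>F x in tail A. \<gamma> \<le> dist_from v A c"
    using eventually_in_ball[OF assms] eventually_dist[of c]
    by eventually_elim (use recenter(2)[OF assms c] in auto)
  then show "\<gamma> \<le> dist_from v A c" using tail_nonbot by simp
next
  assume "\<gamma> \<le> dist_from v A c"
  then show "c \<in> ball_at A \<gamma>"
    using dist_outside_ball(2)[OF assms, of c] ball_at_nonempty[OF assms] by force
qed

text \<open>This replaces the strict increase along a pseudo Cauchy sequence: every point is eventually
  left behind.\<close>

lemma eventually_dist_greater: "\<forall>\<^sub>F x in tail A. dist_from v A c < dist_from v A x"
proof -
  obtain \<gamma> where \<gamma>: "\<gamma> \<in> supp A" "c \<notin> ball_at A \<gamma>" using outside_some_ball by blast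
  show ?thesis using eventually_in_ball[OF \<gamma>(1)]
    by eventually_elim (use \<gamma> mem_ball_at_iff in force)
qed

lemma dist_less_supp:
  "\<exists>\<gamma>\<in>supp A. dist_from v A c < \<gamma>"
  using outside_some_ball[of c] mem_ball_at_iff not_le by metis

lemma dist_value_group:
  "dist_from v A c \<in> Fin ` value_group UNIV v"
proof -
  obtain x where x: "v (x - c) = dist_from v A c"
    using eventually_happens'[OF tail_nonbot eventually_dist[of c]] by blast
  obtain \<gamma> where "dist_from v A c < \<gamma>" using dist_less_supp by blast
  then obtain e where "dist_from v A c = Fin e" by (cases "dist_from v A c") auto
  with x show ?thesis by (auto simp: value_group_def)
qed

lemma dist_in_supp: "dist_from v A c \<in> supp A"
proof -
  obtain \<gamma> where \<gamma>: "\<gamma> \<in> supp A" "dist_from v A c < \<gamma>" using dist_less_supp by blast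
  obtain e where e: "e \<in> value_group UNIV v" "dist_from v A c = Fin e" using dist_value_group by blast
  then show ?thesis using supp_below(1)[OF \<gamma>(1) e(1)] \<gamma>(2) by simp
qed

lemma v_less_iff_dist:
  assumes "Fin \<gamma> < dist_from v A c"
  shows "Fin \<gamma> < v (x - c) \<longleftrightarrow> Fin \<gamma> < dist_from v A x"
proof -
  have "\<forall>\<^sub>F y in tail A. v (y - c) = dist_from v A c \<and> v (y - x) = dist_from v A x"
    using eventually_dist eventually_dist by (rule eventually_conj)
  then obtain y where "v (y - c) = dist_from v A c" "v (y - x) = dist_from v A x"
    using eventually_happens'[OF tail_nonbot] by blast
  then show ?thesis
    using assms v_tri_less[of "Fin \<gamma>" x y c] v_tri_less[of "Fin \<gamma>" y c x]
      v_commute[of x y] v_commute[of c x] by auto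
qed

text \<open>The function \<open>dist_from v A\<close> determines \<open>A\<close>, by the same formulas that define \<open>appr\<close> from the
  values of \<open>x - c\<close>. Therefore \<open>x\<close> has approximation type \<open>A\<close> as soon as these values agree with
  \<open>dist_from v A c\<close>.\<close>

lemma Closed_mem_iff:
  "Closed \<gamma> S \<in> A \<longleftrightarrow> \<gamma> \<in> closed_radii v \<and> S = {c. \<gamma> \<le> dist_from v A c} \<and> S \<noteq> {}"
proof
  assume S: "Closed \<gamma> S \<in> A"
  then have \<gamma>: "\<gamma> \<in> supp A" by (auto simp: supp_def)
  have "S = ball_at A \<gamma>" using ball_at_eq[OF val_v appr_type S] by simp
  then show "\<gamma> \<in> closed_radii v \<and> S = {c. \<gamma> \<le> dist_from v A c} \<and> S \<noteq> {}"
    using ball_at_nonempty[OF \<gamma>] mem_ball_at_iff[OF \<gamma>] supp_value_group[OF \<gamma>]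
    by (auto simp: closed_radii_def)
next
  assume S: "\<gamma> \<in> closed_radii v \<and> S = {c. \<gamma> \<le> dist_from v A c} \<and> S \<noteq> {}"
  then obtain c where c: "\<gamma> \<le> dist_from v A c" by blast
  obtain \<delta> where \<delta>: "\<delta> \<in> supp A" "dist_from v A c < \<delta>" using dist_less_supp by blast
  then have "\<gamma> < \<delta>" using c by order
  then obtain e where "\<gamma> = Fin e" "e \<in> value_group UNIV v"
    using S by (auto simp: closed_radii_def)
  then have \<gamma>: "\<gamma> \<in> supp A" using supp_below(1) \<delta> \<open>\<gamma> < \<delta>\<close> by blast
  then have "c \<in> ball_at A \<gamma>" using c mem_ball_at_iff by blast
  then have "Closed \<gamma> (ball_at A \<gamma>) \<in> A" using recenter[OF \<gamma>, of c] by (simp add: closed_ball_def)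
  moreover have "S = ball_at A \<gamma>" using S mem_ball_at_iff[OF \<gamma>] by blast
  ultimately show "Closed \<gamma> S \<in> A" by simp
qed

lemma Open_mem_iff:
  "Open e S \<in> A \<longleftrightarrow> e \<in> value_group UNIV v \<and> S = {c. Fin e < dist_from v A c} \<and> S \<noteq> {}"
proof
  assume S: "Open e S \<in> A"
  then obtain c where c: "Open e S = open_ball v e c" and e: "e \<in> value_group UNIV v"
    by (cases rule: ball_cases) (auto simp: closed_ball_def open_ball_def)
  then have "Fin e \<in> supp A" using S closed_of_open supp_iff by metis
  then obtain \<delta> where \<delta>: "\<delta> \<in> supp A" "Fin e < \<delta>" using supp_no_max by blast
  then obtain d where d: "d \<in> ball_at A \<delta>" using ball_at_nonempty by blast
  then have "open_ball v e d \<in> A" using supp_below(2)[OF \<delta>(1) e \<delta>(2)] by blast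
  then have dc: "Fin e < v (d - c)" using open_balls_meet[of e c d] c S by simp
  have "S = {x. Fin e < v (x - c)}" using c by (simp add: open_ball_def)
  also have "\<dots> = {x. Fin e < v (x - d)}"
    using dc v_tri_less[of "Fin e" _ d c] v_tri_less[of "Fin e" _ c d] v_commute[of c d] by auto
  also have "\<dots> = {x. Fin e < dist_from v A x}"
    using v_less_iff_dist[of e d] d mem_ball_at_iff[OF \<delta>(1)] \<delta>(2) by fastforce
  finally have "S = {x. Fin e < dist_from v A x}" .
  moreover have "c \<in> S" using c center_mem(2)[of c e] by (metis points.simps(2))
  ultimately show "e \<in> value_group UNIV v \<and> S = {c. Fin e < dist_from v A c} \<and> S \<noteq> {}"
    using e by blast
next
  assume S: "e \<in> value_group UNIV v \<and> S = {c. Fin e < dist_from v A c} \<and> S \<noteq> {}"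
  then obtain c where c: "Fin e < dist_from v A c" by blast
  have "c \<in> ball_at A (dist_from v A c)" using mem_ball_at_iff dist_in_supp by blast
  then have "open_ball v e c \<in> A" using supp_below(2)[OF dist_in_supp _ c] S by blast
  then show "Open e S \<in> A" using S v_less_iff_dist[OF c] by (simp add: open_ball_def)
qed

end

section \<open>Polynomials of small degree in extensions\<close>

lemma map_vinf_mono_iff:
  assumes "strict_mono_on G \<phi>" "\<gamma> \<in> insert Infty (Fin ` G)" "\<delta> \<in> insert Infty (Fin ` G)"
  shows "map_vinf \<phi> \<gamma> < map_vinf \<phi> \<delta> \<longleftrightarrow> \<gamma> < (\<delta> :: 'g::linordered_ab_group_add vinf)"
    and "map_vinf \<phi> \<gamma> \<le> map_vinf \<phi> \<delta> \<longleftrightarrow> \<gamma> \<le> \<delta>"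
proof -
  have less: "map_vinf \<phi> \<gamma> < map_vinf \<phi> \<delta> \<longleftrightarrow> \<gamma> < \<delta>"
    if "\<gamma> \<in> insert Infty (Fin ` G)" "\<delta> \<in> insert Infty (Fin ` G)" for \<gamma> \<delta>
    using that strict_mono_on_less[OF assms(1)] by auto
  show "map_vinf \<phi> \<gamma> < map_vinf \<phi> \<delta> \<longleftrightarrow> \<gamma> < \<delta>"
    using less[OF assms(2,3)] .
  show "map_vinf \<phi> \<gamma> \<le> map_vinf \<phi> \<delta> \<longleftrightarrow> \<gamma> \<le> \<delta>"
    using less[OF assms(3,2)] by (simp add: not_less[symmetric])
qed

abbreviation eval_via :: "('k::comm_ring_1 \<Rightarrow> 'l::comm_ring_1) \<Rightarrow> 'k poly \<Rightarrow> 'l \<Rightarrow> 'l" where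
  "eval_via \<iota> g x \<equiv> poly (map_poly \<iota> g) x"

text \<open>In this locale the type \<open>A\<close> is given over the base field; it is the approximation type
  of an element of \<open>L\<close> only where this is assumed.\<close>

locale extension_of_approximation = immediate_approximation v A
  for v :: "'k::field \<Rightarrow> 'g::linordered_ab_group_add vinf" and A :: "('k, 'g) vball set" +
  fixes \<iota> :: "'k \<Rightarrow> 'l::field" and \<phi> :: "'g \<Rightarrow> 'h::linordered_ab_group_add"
    and L :: "'l set" and w :: "'l \<Rightarrow> 'h vinf"
  assumes extension: "valued_extension v \<iota> \<phi> L w"
begin

sublocale L: valued_subfield L w
  using extension by unfold_locales (auto simp: valued_extension_def)

sublocale \<iota>: field_hom \<iota>
  using extension by (simp add: valued_extension_def)

lemma \<iota>_mem: "\<iota> c \<in> L" and w_\<iota>: "w (\<iota> c) = map_vinf \<phi> (v c)"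
  and \<phi>_strict_mono: "strict_mono_on (value_group UNIV v) \<phi>"
  using extension by (auto simp: valued_extension_def)

lemma eval_via_mem: "x \<in> L \<Longrightarrow> eval_via \<iota> g x \<in> L"
  by (rule L.poly_mem) (simp_all add: \<iota>_mem)

lemma \<phi>_add:
  assumes "\<gamma> \<in> value_group UNIV v" "\<delta> \<in> value_group UNIV v"
  shows "\<phi> (\<gamma> + \<delta>) = \<phi> \<gamma> + \<phi> \<delta>"
proof -
  obtain c d where "v c = Fin \<gamma>" "v d = Fin \<delta>" using assms by (auto simp: value_group_def)
  then have "Fin (\<phi> (\<gamma> + \<delta>)) = w (\<iota> c * \<iota> d)"
    using w_\<iota>[of "c * d"] K.val_mult[of c d] by (simp add: \<iota>.hom_mult)
  also have "\<dots> = Fin (\<phi> \<gamma> + \<phi> \<delta>)"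
    using \<open>v c = _\<close> \<open>v d = _\<close> w_\<iota> L.val_mult[OF \<iota>_mem \<iota>_mem] by simp
  finally show ?thesis by simp
qed

lemma dist_closed_radii: "dist_from v A c \<in> insert Infty (Fin ` value_group UNIV v)"
  using dist_value_group[of c] by blast

lemma appr_eq_of_dist:
  assumes "\<And>c. w (x - \<iota> c) = map_vinf \<phi> (dist_from v A c)"
  shows "appr v \<iota> \<phi> w x = A"
proof -
  have cl: "{c. map_vinf \<phi> \<gamma> \<le> w (x - \<iota> c)} = {c. \<gamma> \<le> dist_from v A c}" if "\<gamma> \<in> closed_radii v" for \<gamma>
    using map_vinf_mono_iff(2)[OF \<phi>_strict_mono _ dist_closed_radii] that
    by (simp add: closed_radii_def assms)
  have op: "{c. Fin (\<phi> \<gamma>) < w (x - \<iota> c)} = {c. Fin \<gamma> < dist_from v A c}"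
    if "\<gamma> \<in> value_group UNIV v" for \<gamma>
    using map_vinf_mono_iff(1)[OF \<phi>_strict_mono _ dist_closed_radii, of "Fin \<gamma>"] that
    by (simp add: assms)
  have "B \<in> appr v \<iota> \<phi> w x \<longleftrightarrow> B \<in> A" for B
    by (cases B; simp add: appr_def Closed_mem_iff Open_mem_iff cl op cong: conj_cong; blast)
  then show ?thesis by blast
qed

text \<open>An element \<open>y\<close> of a ball of \<open>A\<close> of radius above \<open>dist_from v A c\<close> is closer to \<open>x\<close> than to \<open>c\<close>, so
  \<open>x\<close> and \<open>y\<close> have the same distance from \<open>c\<close>.\<close>

lemma dist_of_appr_eq:
  assumes appr: "appr v \<iota> \<phi> w x = A" and x: "x \<in> L"
  shows "w (x - \<iota> c) = map_vinf \<phi> (dist_from v A c)"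
proof -
  obtain \<gamma> where \<gamma>: "\<gamma> \<in> supp A" "dist_from v A c < \<gamma>" using dist_less_supp by blast
  have "\<forall>\<^sub>F y in tail A. v (y - c) = dist_from v A c \<and> y \<in> ball_at A \<gamma>"
    using eventually_dist eventually_in_ball[OF \<gamma>(1)] by (rule eventually_conj)
  then obtain y where y: "v (y - c) = dist_from v A c" "y \<in> ball_at A \<gamma>"
    using eventually_happens'[OF tail_nonbot] by blast
  have "Closed \<gamma> (ball_at A \<gamma>) \<in> appr v \<iota> \<phi> w x"
    using recenter[OF \<gamma>(1) y(2)] appr by (simp add: closed_ball_def)
  then have "map_vinf \<phi> \<gamma> \<le> w (x - \<iota> y)" using y(2) by (auto simp: appr_def)
  moreover have "map_vinf \<phi> (dist_from v A c) < map_vinf \<phi> \<gamma>"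
  proof -
    obtain e where "e \<in> value_group UNIV v" "\<gamma> = Fin e" using supp_value_group[OF \<gamma>(1)] by blast
    then show ?thesis using map_vinf_mono_iff(1)[OF \<phi>_strict_mono dist_closed_radii, of \<gamma> c] \<gamma>(2) by simp
  qed
  moreover have "w (\<iota> y - \<iota> c) = map_vinf \<phi> (dist_from v A c)"
    using w_\<iota>[of "y - c"] y(1) by (simp add: \<iota>.hom_minus)
  ultimately have "w (\<iota> y - \<iota> c) < w (x - \<iota> y)" by order
  then have "w ((\<iota> y - \<iota> c) + (x - \<iota> y)) = w (\<iota> y - \<iota> c)"
    using x by (intro L.val_add_dominant L.minus_mem \<iota>_mem)
  then show ?thesis using \<open>w (\<iota> y - \<iota> c) = _\<close> by simp
qed

text \<open>The main step, a form of a lemma of Kaplansky. In the expansion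
  \<open>g(x) - g(c) = \<Sum>\<^sub>i\<^sub>\<ge>\<^sub>1 d\<^sub>i(c) (x - c)\<^sup>i\<close> the values \<open>\<beta>\<^sub>i\<close> of the coefficients are eventually constant,
  while the value \<open>\<eta>\<close> of \<open>x - c\<close> eventually exceeds any given distance. The summands have the values
  \<open>\<beta>\<^sub>i + i\<eta>\<close>; two of them agree for at most one \<open>\<eta>\<close>, so eventually they are pairwise distinct and
  \<open>g(x) - g(c)\<close> has the least of them as its value. As each of them strictly increases with \<open>\<eta>\<close>, so
  does the least one. Keeping \<open>\<mu>\<close> finite excludes the case of a constant \<open>g\<close>.\<close>

lemma eval_difference_not_eventually_constant:
  assumes x: "x \<in> L" and dist: "\<And>c. w (x - \<iota> c) = map_vinf \<phi> (dist_from v A c)"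
    and fixed: "\<And>h. degree h \<le> degree g \<Longrightarrow> fixes_value v A h"
    and fin: "\<mu> \<noteq> Infty"
  shows "\<not> (\<forall>\<^sub>F c in tail A. w (eval_via \<iota> g x - \<iota> (poly g c)) = \<mu>)"
proof
  assume const: "\<forall>\<^sub>F c in tail A. w (eval_via \<iota> g x - \<iota> (poly g c)) = \<mu>"
  have "\<exists>d. \<forall>i. degree (d i) \<le> degree g \<and> (\<forall>c. coeff (g \<circ>\<^sub>p [:c, 1:]) i = poly (d i) c)"
    by (rule choice) (rule allI, rule taylor_coefficient)
  then obtain d where deg: "\<And>i. degree (d i) \<le> degree g"
    and coeff: "\<And>i c. coeff (g \<circ>\<^sub>p [:c, 1:]) i = poly (d i) c" by blast
  define b where "b i = map_vinf \<phi> (eventual_value v A (d i))" for i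
  \<comment> \<open>Summands whose coefficient eventually vanishes have to be left out.\<close>
  define I where "I = {i \<in> {1..degree g}. b i \<noteq> Infty}"
  define \<beta> where "\<beta> i = (case b i of Fin e \<Rightarrow> e | Infty \<Rightarrow> 0)" for i
  define \<eta> where "\<eta> c = (case w (x - \<iota> c) of Fin e \<Rightarrow> e | Infty \<Rightarrow> 0)" for c
  define t where "t i c = \<beta> i + nmult i (\<eta> c)" for i c
  define summand where "summand c i = \<iota> (poly (d i) c) * (x - \<iota> c) ^ i" for c i

  have \<eta>: "w (x - \<iota> c) = Fin (\<eta> c)" for c
    using dist[of c] dist_value_group[of c] by (auto simp: \<eta>_def)
  have \<eta>_greater: "\<forall>\<^sub>F c' in tail A. \<eta> c < \<eta> c'" for c
    using eventually_dist_greater[of c]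
  proof eventually_elim
    case (elim c')
    then have "w (x - \<iota> c) < w (x - \<iota> c')"
      unfolding dist using map_vinf_mono_iff(1)[OF \<phi>_strict_mono dist_closed_radii dist_closed_radii] by blast
    then show ?case by (simp add: \<eta>)
  qed
  have x\<iota>: "x - \<iota> c \<in> L" for c using x \<iota>_mem L.minus_mem by blast
  have summand_mem: "summand c i \<in> L" for c i
    unfolding summand_def by (intro L.mult_mem L.power_mem x\<iota> \<iota>_mem)

  define good where "good c \<longleftrightarrow> (\<forall>i\<in>{1..degree g}. w (\<iota> (poly (d i) c)) = b i)" for c
  have good: "\<forall>\<^sub>F c in tail A. good c"
    unfolding good_def
  proof (intro eventually_ball_finite ballI)
    fix i
    show "\<forall>\<^sub>F c in tail A. w (\<iota> (poly (d i) c)) = b i"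
      using eventually_eventual_value[OF fixed[OF deg[of i]]]
      by eventually_elim (simp add: w_\<iota> b_def)
  qed simp
  have val_summand: "w (summand c i) = Fin (t i c)" if "good c" "i \<in> I" for c i
  proof -
    have "w (\<iota> (poly (d i) c)) = Fin (\<beta> i)"
      using that by (auto simp: good_def I_def \<beta>_def split: vinf.splits)
    then show ?thesis unfolding summand_def t_def
      using L.val_mult[OF \<iota>_mem L.power_mem[OF x\<iota>]] L.val_power[OF x\<iota> \<eta>] by simp
  qed
  have expand: "eval_via \<iota> g x - \<iota> (poly g c) = sum (summand c) I" if "good c" for c
  proof -
    have "eval_via \<iota> g x = poly (map_poly \<iota> (g \<circ>\<^sub>p [:c, 1:])) (x - \<iota> c)"
      by (simp add: \<iota>.map_poly_pcompose poly_pcompose \<iota>.map_poly_pCons_hom)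
    also have "\<dots> = (\<Sum>i\<le>degree g. summand c i)"
      by (simp add: poly_altdef degree_pcompose coeff summand_def)
    also have "\<dots> = summand c 0 + (\<Sum>i=1..degree g. summand c i)"
      by (simp add: sum.atLeast_Suc_atMost atMost_atLeast0)
    also have "summand c 0 = \<iota> (poly g c)"
      using coeff[of c 0] by (simp add: summand_def)
    also have "(\<Sum>i=1..degree g. summand c i) = sum (summand c) I"
    proof (rule sum.mono_neutral_right)
      show "\<forall>i\<in>{1..degree g} - I. summand c i = 0"
        using that L.val_eq_Infty[OF \<iota>_mem] by (auto simp: good_def I_def summand_def)
    qed (auto simp: I_def)
    finally show ?thesis by simp
  qed

  \<comment> \<open>If the values agree at \<open>c\<^sub>0\<close>, they differ as soon as \<open>\<eta>\<close> exceeds its value at \<open>c\<^sub>0\<close>.\<close>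
  have distinct: "\<forall>\<^sub>F c in tail A. t i c \<noteq> t j c" if "i < j" for i j
  proof (cases "\<exists>c\<^sub>0. t i c\<^sub>0 = t j c\<^sub>0")
    case True
    then obtain c\<^sub>0 where c\<^sub>0: "t i c\<^sub>0 = t j c\<^sub>0" by blast
    obtain k where k: "j = i + k" "0 < k" using less_imp_add_positive[OF \<open>i < j\<close>] by metis
    show ?thesis using \<eta>_greater[of c\<^sub>0]
    proof eventually_elim
      case (elim c)
      then have "nmult k (\<eta> c\<^sub>0) < nmult k (\<eta> c)" using k(2) nmult_strict_mono by blast
      moreover have "\<beta> i = \<beta> j + nmult k (\<eta> c\<^sub>0)"
        using c\<^sub>0 by (simp add: t_def k(1) nmult_add algebra_simps)
      ultimately show ?case by (simp add: t_def k(1) nmult_add algebra_simps)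
    qed
  qed simp
  have "\<forall>\<^sub>F c in tail A. \<forall>i\<in>I. \<forall>j\<in>I. i < j \<longrightarrow> t i c \<noteq> t j c"
    using distinct by (intro eventually_ball_finite ballI) (auto simp: I_def intro: eventually_mono)
  with good const have P: "\<forall>\<^sub>F c in tail A. good c \<and> w (sum (summand c) I) = \<mu> \<and> inj_on (\<lambda>i. w (summand c i)) I"
  proof eventually_elim
    case (elim c)
    have "inj_on (\<lambda>i. w (summand c i)) I"
    proof (rule linorder_inj_onI)
      fix i j assume "i < j" "i \<in> I" "j \<in> I"
      then show "w (summand c i) \<noteq> w (summand c j)" using elim val_summand by simp
    qed (rule linear)
    with elim expand show ?case by simp
  qed
  obtain c where c: "good c" "w (sum (summand c) I) = \<mu>" "inj_on (\<lambda>i. w (summand c i)) I"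
    using eventually_happens'[OF tail_nonbot P] by blast
  obtain c' where c': "good c'" "w (sum (summand c') I) = \<mu>" "inj_on (\<lambda>i. w (summand c' i)) I" "\<eta> c < \<eta> c'"
    using eventually_happens'[OF tail_nonbot eventually_conj[OF P \<eta>_greater[of c]]] by blast
  have "finite I" by (simp add: I_def)
  moreover have "I \<noteq> {}" using c(2) fin L.val_zero by (metis sum.empty)
  ultimately have I: "finite I" "I \<noteq> {}" .
  have "\<exists>i\<in>I. w (sum (summand c) I) = w (summand c i) \<and> (\<forall>j\<in>I. w (summand c i) \<le> w (summand c j))"
    by (rule L.val_sum_distinct[OF I summand_mem _ c(3)]) (use val_summand[OF c(1)] in auto)
  then obtain i where i: "\<mu> = Fin (t i c)" "\<And>j. j \<in> I \<Longrightarrow> t i c \<le> t j c"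
    using val_summand[OF c(1)] c(2) by auto
  have "\<exists>j\<in>I. w (sum (summand c') I) = w (summand c' j)"
    by (rule L.val_sum_distinct[OF I summand_mem _ c'(3)]) (use val_summand[OF c'(1)] in auto)
  then obtain j where j: "j \<in> I" "\<mu> = Fin (t j c')"
    using val_summand[OF c'(1)] c'(2) by auto
  have "nmult j (\<eta> c) < nmult j (\<eta> c')"
    using nmult_strict_mono[OF c'(4)] j(1) by (simp add: I_def)
  then have "t j c < t j c'" by (simp add: t_def)
  then show False using i j by fastforce
qed

text \<open>If \<open>g(x)\<close> had another value than \<open>g(c)\<close> has eventually, then \<open>g(x) - g(c)\<close> would eventually have
  the constant value given by the smaller of the two. So the value of \<open>g(x)\<close> is forced by \<open>A\<close>; this
  is what makes the extension unique.\<close>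

lemma val_eval_via:
  assumes x: "x \<in> L" and dist: "\<And>c. w (x - \<iota> c) = map_vinf \<phi> (dist_from v A c)"
    and fixed: "\<And>h. degree h \<le> degree g \<Longrightarrow> fixes_value v A h"
  shows "w (eval_via \<iota> g x) = map_vinf \<phi> (eventual_value v A g)"
proof (rule ccontr)
  let ?\<alpha> = "map_vinf \<phi> (eventual_value v A g)"
  assume neq: "w (eval_via \<iota> g x) \<noteq> ?\<alpha>"
  have "\<forall>\<^sub>F c in tail A. w (eval_via \<iota> g x - \<iota> (poly g c)) = min (w (eval_via \<iota> g x)) ?\<alpha>"
    using eventually_eventual_value[OF fixed[OF order_refl]]
    by eventually_elim (use neq w_\<iota> L.val_diff_unequal[OF eval_via_mem[OF x] \<iota>_mem] in simp)
  moreover have "min (w (eval_via \<iota> g x)) ?\<alpha> \<noteq> Infty"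
    using neq by (cases "w (eval_via \<iota> g x)"; cases ?\<alpha>) (auto simp: min_def)
  ultimately show False
    using eval_difference_not_eventually_constant[OF x dist fixed] by blast
qed

end

section \<open>Algebraic approximation types\<close>

context immediate_approximation
begin

lemma eventual_value_attained:
  assumes "fixes_value v A g"
  shows "\<exists>c. v (poly g c) = eventual_value v A g"
  using eventually_happens'[OF tail_nonbot eventually_eventual_value[OF assms]] by blast

text \<open>Each of the finitely many roots is eventually left behind.\<close>

lemma eventually_nonroot:
  assumes "g \<noteq> 0"
  shows "\<forall>\<^sub>F c in tail A. poly g c \<noteq> 0"
proof -
  have "\<forall>\<^sub>F c in tail A. \<forall>r\<in>{r. poly g r = 0}. dist_from v A r < dist_from v A c"
    using poly_roots_finite[OF assms] eventually_dist_greater by (intro eventually_ball_finite) auto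
  then show ?thesis by eventually_elim auto
qed

lemma eventual_value_nonzero:
  assumes "g \<noteq> 0" "fixes_value v A g"
  shows "eventual_value v A g \<noteq> Infty"
proof -
  have "\<forall>\<^sub>F c in tail A. v (poly g c) = eventual_value v A g \<and> poly g c \<noteq> 0"
    using eventually_eventual_value[OF assms(2)] eventually_nonroot[OF assms(1)] by (rule eventually_conj)
  then obtain c where "v (poly g c) = eventual_value v A g" "poly g c \<noteq> 0"
    using eventually_happens'[OF tail_nonbot] by blast
  then show ?thesis using K.val_eq_Infty[of "poly g c"] by auto
qed

lemma eventual_value_const: "eventual_value v A [:c:] = v c"
  by (rule eventual_value_eq) simp

lemma fixes_const: "fixes_value v A [:c:]"
  unfolding fixes_value_iff by (rule exI[of _ "v c"]) simp

lemma eventually_value_mult: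
  assumes "fixes_value v A g" "fixes_value v A h"
  shows "\<forall>\<^sub>F c in tail A. v (poly (g * h) c) = eventual_value v A g + eventual_value v A h"
  using eventually_eventual_value[OF assms(1)] eventually_eventual_value[OF assms(2)]
  by eventually_elim (simp add: K.val_mult)

lemma fixes_mult: "fixes_value v A g \<Longrightarrow> fixes_value v A h \<Longrightarrow> fixes_value v A (g * h)"
  using eventually_value_mult fixes_value_iff by blast

lemma eventual_value_add:
  assumes "fixes_value v A g" "fixes_value v A h" "fixes_value v A (g + h)"
  shows "min (eventual_value v A g) (eventual_value v A h) \<le> eventual_value v A (g + h)"
proof -
  have "\<forall>\<^sub>F c in tail A. min (eventual_value v A g) (eventual_value v A h) \<le> eventual_value v A (g + h)"
    using assms[THEN eventually_eventual_value]
  proof eventually_elim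
    case (elim c)
    then show ?case using K.val_add[of "poly g c" "poly h c"] by simp
  qed
  then show ?thesis using tail_nonbot by simp
qed

lemma fixes_value_cancel:
  assumes "q \<noteq> 0" "fixes_value v A q" "fixes_value v A (q * f)"
  shows "fixes_value v A f"
proof -
  obtain k where k: "eventual_value v A q = Fin k"
    using eventual_value_nonzero[OF assms(1,2)] by (cases "eventual_value v A q") auto
  define \<alpha> where "\<alpha> = Fin (- k) + eventual_value v A (q * f)"
  have "\<forall>\<^sub>F c in tail A. v (poly f c) = \<alpha>"
    using assms(2,3)[THEN eventually_eventual_value]
  proof eventually_elim
    case (elim c)
    have "\<alpha> = Fin (- k) + (Fin k + v (poly f c))"
      using elim k by (simp add: \<alpha>_def K.val_mult)
    also have "\<dots> = v (poly f c)" by (cases "v (poly f c)") auto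
    finally show ?case by simp
  qed
  then show ?thesis using fixes_value_iff by blast
qed

end

locale algebraic_approximation = immediate_approximation v A
  for v :: "'k::field \<Rightarrow> 'g::linordered_ab_group_add vinf" and A :: "('k, 'g) vball set" +
  fixes f :: "'k poly"
  assumes minimal: "associated_minimal_polynomial v A f"
begin

lemma monic: "lead_coeff f = 1" and not_fixed: "\<not> fixes_value v A f"
  and fixes_small: "degree g < degree f \<Longrightarrow> fixes_value v A g"
  using minimal not_le by (auto simp: associated_minimal_polynomial_def)

lemma f_nonzero: "f \<noteq> 0"
  using monic by auto

text \<open>Constant and linear polynomials always have a fixed value.\<close>

lemma degree_f: "1 < degree f"
proof (rule ccontr)
  assume "\<not> 1 < degree f"
  then have "degree f \<le> 1" by simp
  then obtain p q where "f = [:p, q:]" using degree1_coeffs[of f] degree0_coeffs[of f]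
    by (metis One_nat_def le_SucE le_zero_eq pCons_0_0)
  then have "f = [:p:] \<or> f = [:- (- p), 1:]" using monic by (cases "q = 0") auto
  then show False using not_fixed fixes_const fixes_linear by metis
qed

text \<open>Fixed values are preserved by products, so \<open>f\<close> is irreducible.\<close>

lemma no_proper_factor:
  assumes "f = g * h" "degree g < degree f"
  shows "degree g = 0"
proof (rule ccontr)
  assume "degree g \<noteq> 0"
  moreover have "degree f = degree g + degree h"
    using assms(1) f_nonzero by (simp add: degree_mult_eq)
  ultimately have "fixes_value v A g" "fixes_value v A h" using fixes_small assms(2) by simp_all
  then show False using not_fixed fixes_mult assms(1) by blast
qed

lemma degree_mod_f: "degree (p mod f) < degree f"
  using degree_mod_less'[of f p] degree_f f_nonzero by (cases "p mod f = 0") auto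

text \<open>This is the multiplicativity of the valuation on the residues modulo \<open>f\<close>. With
  \<open>g h = q f + r\<close>, the values of \<open>g h\<close>, of \<open>r\<close> and of \<open>q\<close> are fixed for reasons of degree. If those of
  \<open>g h\<close> and \<open>r\<close> were different, then the value of \<open>q f = g h - r\<close> would be fixed as their minimum, and
  hence that of \<open>f\<close>.\<close>

lemma eventual_value_mult_mod:
  assumes g: "degree g < degree f" and h: "degree h < degree f"
  shows "eventual_value v A (g * h mod f) = eventual_value v A g + eventual_value v A h"
proof (rule ccontr)
  let ?q = "g * h div f" and ?r = "g * h mod f"
  let ?\<alpha> = "eventual_value v A g + eventual_value v A h"
  assume neq: "eventual_value v A ?r \<noteq> ?\<alpha>"
  note gh = eventually_value_mult[OF fixes_small[OF g] fixes_small[OF h]]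
  have qf: "?q * f = g * h - ?r" by (simp add: minus_mod_eq_div_mult)
  have "?q \<noteq> 0"
  proof
    assume "?q = 0"
    then have "?r = g * h" using qf by simp
    then show False using neq eventual_value_eq[OF gh] by simp
  qed
  have "degree (?q * f) \<le> max (degree (g * h)) (degree ?r)"
    unfolding qf by (rule degree_diff_le_max)
  also have "\<dots> < degree f + degree f"
    using degree_mult_le[of g h] g h degree_mod_f[of "g * h"] by simp
  finally have "degree ?q < degree f"
    using \<open>?q \<noteq> 0\<close> f_nonzero by (simp add: degree_mult_eq)
  have "\<forall>\<^sub>F c in tail A. v (poly (?q * f) c) = min ?\<alpha> (eventual_value v A ?r)"
    using gh eventually_eventual_value[OF fixes_small[OF degree_mod_f[of "g * h"]]]
  proof eventually_elim
    case (elim c)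
    then show ?case unfolding qf
      using neq K.val_diff_unequal[of "poly (g * h) c" "poly ?r c"] by simp
  qed
  then have "fixes_value v A (?q * f)" using fixes_value_iff by blast
  then show False
    using fixes_value_cancel[OF \<open>?q \<noteq> 0\<close> fixes_small[OF \<open>degree ?q < degree f\<close>]] not_fixed by blast
qed

end

section \<open>Simple extensions\<close>

locale root_of_minimal_polynomial = algebraic_approximation v A f
  for v :: "'k::field \<Rightarrow> 'g::linordered_ab_group_add vinf" and A :: "('k, 'g) vball set"
    and f :: "'k poly" +
  fixes \<iota> :: "'k \<Rightarrow> 'l::field" and a :: 'l
  assumes hom: "field_hom \<iota>" and root: "eval_via \<iota> f a = 0"
begin

sublocale \<iota>: field_hom \<iota> by (rule hom)
sublocale \<iota>_poly: map_poly_inj_idom_hom \<iota> ..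

abbreviation ev :: "'k poly \<Rightarrow> 'l" where "ev g \<equiv> eval_via \<iota> g a"

lemma ev_mod: "ev (p mod f) = ev p"
proof -
  have "ev p = ev (p div f * f + p mod f)" by simp
  also have "\<dots> = ev (p mod f)" by (simp only: \<iota>_poly.hom_add \<iota>_poly.hom_mult poly_add poly_mult root) simp
  finally show ?thesis by simp
qed

text \<open>Among the polynomials whose value at \<open>a\<close> is a multiple of \<open>g(a)\<close>, one of least degree divides
  \<open>f\<close>, because the remainder of \<open>f\<close> is again such a polynomial; by irreducibility of \<open>f\<close> it is a
  nonzero constant.\<close>

lemma ev_inverse:
  assumes "g \<noteq> 0" "degree g < degree f"
  shows "\<exists>u. ev u * ev g = 1"
proof -
  define P where "P h \<longleftrightarrow> h \<noteq> 0 \<and> degree h < degree f \<and> (\<exists>u. ev h = ev u * ev g)" for h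
  have "P g" unfolding P_def using assms by (auto intro: exI[of _ 1])
  then obtain h where h: "P h" "\<And>p. P p \<Longrightarrow> degree h \<le> degree p"
    using ex_has_least_nat[of P g degree] by blast
  then obtain u where u: "ev h = ev u * ev g" by (auto simp: P_def)
  have "f mod h = 0"
  proof (rule ccontr)
    assume nz: "f mod h \<noteq> 0"
    then have less: "degree (f mod h) < degree h" using h(1) degree_mod_less'[of h f] by (simp add: P_def)
    have "f mod h = f - f div h * h" by (simp add: minus_div_mult_eq_mod)
    then have "ev (f mod h) = ev (- (f div h) * u) * ev g"
      using u by (simp add: \<iota>_poly.hom_mult \<iota>_poly.hom_minus \<iota>_poly.hom_uminus root)
    then have "P (f mod h)" using nz less h(1) unfolding P_def by auto
    then show False using h(2) less by fastforce
  qed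
  then have "f = h * (f div h)" by auto
  then have "degree h = 0" using no_proper_factor h(1) by (simp add: P_def)
  then obtain c where c: "h = [:c:]" using degree0_coeffs by blast
  then have "c \<noteq> 0" using h(1) by (simp add: P_def)
  have "ev (smult (inverse c) u) * ev g = \<iota> (inverse c) * (ev u * ev g)"
    by (simp add: \<iota>.map_poly_hom_smult)
  also have "ev u * ev g = \<iota> c" using u c by (simp add: \<iota>.map_poly_pCons_hom)
  also have "\<iota> (inverse c) * \<iota> c = 1" using \<open>c \<noteq> 0\<close> by (simp flip: \<iota>.hom_mult)
  finally have "ev (smult (inverse c) u) * ev g = 1" .
  then show ?thesis by blast
qed

lemma ev_eq_0: "degree g < degree f \<Longrightarrow> ev g = 0 \<Longrightarrow> g = 0"
  using ev_inverse by (metis mult_zero_right zero_neq_one)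

lemma ev_inj:
  assumes "degree g < degree f" "degree h < degree f" "ev g = ev h"
  shows "g = h"
proof -
  have "degree (g - h) < degree f" using assms(1,2) degree_diff_less by blast
  moreover have "ev (g - h) = 0" using assms(3) by (simp add: \<iota>_poly.hom_minus)
  ultimately show ?thesis using ev_eq_0 by force
qed

lemma ev_const: "ev [:c:] = \<iota> c" and ev_linear: "ev [:- c, 1:] = a - \<iota> c"
  by (simp_all add: \<iota>.map_poly_pCons_hom \<iota>.hom_uminus)

lemma is_subfield_range_ev: "is_subfield (range ev)"
  unfolding is_subfield_def
proof (intro conjI ballI)
  show "1 \<in> range ev" by (rule image_eqI[of _ _ 1]) simp_all
next
  fix x y assume "x \<in> range ev" "y \<in> range ev"
  then obtain p q where "x = ev p" "y = ev q" by blast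
  then have "x - y = ev (p - q)" "x * y = ev (p * q)"
    by (simp_all add: \<iota>_poly.hom_minus \<iota>_poly.hom_mult)
  then show "x - y \<in> range ev" "x * y \<in> range ev" by blast+
next
  fix x assume "x \<in> range ev"
  then obtain p where p: "x = ev (p mod f)" using ev_mod by force
  show "inverse x \<in> range ev"
  proof (cases "p mod f = 0")
    case True
    then show ?thesis using p by (intro image_eqI[of _ _ 0]) auto
  next
    case False
    then obtain u where "ev u * ev (p mod f) = 1" using ev_inverse degree_mod_f by blast
    then have "inverse x = ev u" using p by (metis inverse_unique mult.commute)
    then show ?thesis by blast
  qed
qed

lemma adjoin_eq_range: "adjoin \<iota> a = range ev"
proof
  have "ev [:0, 1:] = a" by (simp add: \<iota>.map_poly_pCons_hom)
  then have "a \<in> range ev" by (metis rangeI)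
  moreover have "range \<iota> \<subseteq> range ev" using ev_const by (metis image_subsetI rangeI)
  ultimately show "adjoin \<iota> a \<subseteq> range ev"
    unfolding adjoin_def using is_subfield_range_ev by blast
next
  show "range ev \<subseteq> adjoin \<iota> a"
    unfolding adjoin_def
  proof (intro subsetI InterI)
    fix y F assume y: "y \<in> range ev" and "F \<in> {F. is_subfield F \<and> range \<iota> \<subseteq> F \<and> a \<in> F}"
    then have F: "is_subfield F" "range \<iota> \<subseteq> F" "a \<in> F" by simp_all
    have closed: "p + q \<in> F" "p * q \<in> F" if "p \<in> F" "q \<in> F" for p q
    proof -
      have *: "0 \<in> F" using F(1) unfolding is_subfield_def by (metis diff_self)
      show "p * q \<in> F" using F(1) that unfolding is_subfield_def by blast
      have "0 - q \<in> F" using * F(1) that unfolding is_subfield_def by blast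
      then have "p - (0 - q) \<in> F" using F(1) that unfolding is_subfield_def by blast
      then show "p + q \<in> F" by simp
    qed
    obtain p where "y = ev p" using y by blast
    moreover have "ev p \<in> F"
    proof (induction p)
      case 0
      show ?case using F(2) \<iota>.hom_zero by (metis \<iota>_poly.hom_zero poly_0 rangeI subsetD)
    next
      case (pCons c p)
      have "\<iota> c + a * ev p \<in> F" using F(2,3) closed pCons.IH by blast
      then show ?case by (simp add: \<iota>.map_poly_pCons_hom)
    qed
    ultimately show "y \<in> F" by simp
  qed
qed

lemma adjoin_cases:
  assumes "y \<in> adjoin \<iota> a"
  shows "\<exists>g. degree g < degree f \<and> y = ev g"
proof -
  obtain p where "y = ev p" using assms adjoin_eq_range by blast
  then have "y = ev (p mod f)" by (simp only: ev_mod)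
  then show ?thesis using degree_mod_f by blast
qed

lemma ev_mem: "ev g \<in> adjoin \<iota> a"
  using adjoin_eq_range by blast

text \<open>By \<open>adjoin_cases\<close> and \<open>ev_inj\<close> every element of \<open>K(a)\<close> is \<open>g(a)\<close> for exactly one \<open>g\<close> of
  degree smaller than that of \<open>f\<close>. Elements outside \<open>K(a)\<close> receive an unspecified value.\<close>

definition ext_val :: "'l \<Rightarrow> 'g vinf" where
  "ext_val y = eventual_value v A (THE g. degree g < degree f \<and> ev g = y)"

lemma ext_val_ev: "degree g < degree f \<Longrightarrow> ext_val (ev g) = eventual_value v A g"
  unfolding ext_val_def by (subst the_equality[of _ g]) (simp_all add: ev_inj)

lemma ext_val_\<iota>: "ext_val (\<iota> c) = v c"
  using ext_val_ev[of "[:c:]"] degree_f eventual_value_const ev_const by simp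

lemma valuation_ext_val: "valuation_on (adjoin \<iota> a) ext_val"
  unfolding valuation_on_def
proof (intro conjI ballI)
  fix x assume "x \<in> adjoin \<iota> a"
  then obtain g where g: "degree g < degree f" "x = ev g" using adjoin_cases by blast
  have "eventual_value v A 0 = Infty" using eventual_value_const[of 0] K.val_zero by simp
  then show "ext_val x = Infty \<longleftrightarrow> x = 0"
    using g ext_val_ev[OF g(1)] ev_eq_0[OF g(1)] eventual_value_nonzero[OF _ fixes_small[OF g(1)]]
    by (cases "g = 0") auto
  fix y assume "y \<in> adjoin \<iota> a"
  then obtain h where h: "degree h < degree f" "y = ev h" using adjoin_cases by blast
  have "x * y = ev (g * h mod f)" using g h ev_mod by (simp add: \<iota>_poly.hom_mult)
  then show "ext_val (x * y) = ext_val x + ext_val y"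
    using g h ext_val_ev degree_mod_f eventual_value_mult_mod by simp
  have "degree (g + h) < degree f" using g h degree_add_less by blast
  moreover have "x + y = ev (g + h)" using g h by (simp add: \<iota>_poly.hom_add)
  ultimately show "min (ext_val x) (ext_val y) \<le> ext_val (x + y)"
    using g h ext_val_ev eventual_value_add fixes_small by simp
qed

lemma is_subfield_adjoin: "is_subfield (adjoin \<iota> a)"
  using is_subfield_range_ev adjoin_eq_range by simp

lemma valued_extension_ext_val: "valued_extension v \<iota> id (adjoin \<iota> a) ext_val"
  unfolding valued_extension_def
proof (intro conjI allI)
  show "range \<iota> \<subseteq> adjoin \<iota> a" using adjoin_eq_range ev_const by (metis image_subsetI rangeI)
  show "ext_val (\<iota> c) = map_vinf id (v c)" for c
    using ext_val_\<iota> by (simp add: vinf.map_id)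
qed (simp_all add: hom is_subfield_adjoin valuation_ext_val strict_mono_on_def)

sublocale adj: extension_of_approximation v A \<iota> id "adjoin \<iota> a" ext_val
  by unfold_locales (rule valued_extension_ext_val)

lemma dist_ext_val: "ext_val (a - \<iota> c) = map_vinf id (dist_from v A c)"
  using ext_val_ev[of "[:- c, 1:]"] degree_f by (simp only: ev_linear vinf.map_id) simp

lemma appr_ext_val: "appr v \<iota> id ext_val a = A"
  by (rule adj.appr_eq_of_dist[OF dist_ext_val])

lemma a_mem: "a \<in> adjoin \<iota> a"
  unfolding adjoin_def by blast

lemma value_group_ext_val: "value_group (adjoin \<iota> a) ext_val = value_group UNIV v"
proof
  show "value_group (adjoin \<iota> a) ext_val \<subseteq> value_group UNIV v"
  proof
    fix \<gamma> assume "\<gamma> \<in> value_group (adjoin \<iota> a) ext_val"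
    then obtain y where "y \<in> adjoin \<iota> a" "ext_val y = Fin \<gamma>" by (auto simp: value_group_def)
    then obtain g where g: "degree g < degree f" "ext_val (ev g) = Fin \<gamma>" using adjoin_cases by blast
    then obtain c where "v (poly g c) = Fin \<gamma>"
      using eventual_value_attained[OF fixes_small[OF g(1)]] ext_val_ev[OF g(1)] by metis
    then show "\<gamma> \<in> value_group UNIV v" by (auto simp: value_group_def)
  qed
  show "value_group UNIV v \<subseteq> value_group (adjoin \<iota> a) ext_val"
  proof
    fix \<gamma> assume "\<gamma> \<in> value_group UNIV v"
    then obtain c where "v c = Fin \<gamma>" by (auto simp: value_group_def)
    then have "ext_val (\<iota> c) = Fin \<gamma>" using ext_val_\<iota> by simp
    then show "\<gamma> \<in> value_group (adjoin \<iota> a) ext_val"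
      using adj.\<iota>_mem unfolding value_group_def by blast
  qed
qed

text \<open>In the essential case \<open>y = g(a)\<close> has value \<open>0\<close>, and then so has \<open>g(c)\<close> eventually. If no \<open>g(c)\<close> had the
  same residue as \<open>g(a)\<close>, then \<open>g(a) - g(c)\<close> would eventually have the constant value \<open>0\<close>.\<close>

lemma residue_approximable:
  assumes "y \<in> adjoin \<iota> a" "0 \<le> ext_val y"
  shows "\<exists>c. 0 < ext_val (y - \<iota> c)"
proof (cases "0 < ext_val y")
  case True
  then show ?thesis by (intro exI[of _ 0]) simp
next
  case False
  then have y0: "ext_val y = 0" using assms(2) by simp
  obtain g where g: "degree g < degree f" "y = ev g" using adjoin_cases assms(1) by blast
  have "\<exists>c. ext_val (y - \<iota> (poly g c)) \<noteq> 0 \<and> 0 \<le> v (poly g c)"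
  proof (rule ccontr)
    assume no: "\<not> ?thesis"
    have "\<forall>\<^sub>F c in tail A. v (poly g c) = 0"
      using eventually_eventual_value[OF fixes_small[OF g(1)]] ext_val_ev[OF g(1)] g(2) y0 by simp
    then have "\<forall>\<^sub>F c in tail A. ext_val (ev g - \<iota> (poly g c)) = 0"
      by eventually_elim (use no g(2) in auto)
    moreover have "fixes_value v A h" if "degree h \<le> degree g" for h
      using that g(1) by (intro fixes_small) simp
    moreover have "(0 :: 'g vinf) \<noteq> Infty" by (simp add: zero_vinf_def)
    ultimately show False
      using adj.eval_difference_not_eventually_constant[OF a_mem dist_ext_val] by blast
  qed
  then obtain c where c: "ext_val (y - \<iota> (poly g c)) \<noteq> 0" "0 \<le> v (poly g c)" by blast
  have "min (ext_val y) (ext_val (\<iota> (poly g c))) \<le> ext_val (y - \<iota> (poly g c))"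
    using assms(1) adj.\<iota>_mem by (rule adj.L.val_diff)
  then have "0 < ext_val (y - \<iota> (poly g c))"
    using c y0 ext_val_\<iota> by (auto simp: min_def split: if_splits)
  then show ?thesis by blast
qed

end

section \<open>The immediate extension generated by a root\<close>

context root_of_minimal_polynomial
begin

lemma residue_embedding_coset:
  "residue_embedding \<iota> (adjoin \<iota> a) ext_val ((+) c ` valuation_ideal UNIV v) =
   (+) (\<iota> c) ` valuation_ideal (adjoin \<iota> a) ext_val" (is "?L = ?R")
proof
  show "?L \<subseteq> ?R"
  proof
    fix x assume "x \<in> ?L"
    then obtain \<mu> m where x: "x = \<iota> (c + \<mu>) + m" "0 < v \<mu>" "m \<in> adjoin \<iota> a" "0 < ext_val m"
      by (auto simp: residue_embedding_def valuation_ideal_def)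
    have "min (ext_val (\<iota> \<mu>)) (ext_val m) \<le> ext_val (\<iota> \<mu> + m)"
      using adj.\<iota>_mem x(3) by (rule adj.L.val_add)
    then have "0 < ext_val (\<iota> \<mu> + m)"
      using x(2,4) ext_val_\<iota>[of \<mu>] by (auto simp: min_def split: if_splits)
    then have "\<iota> \<mu> + m \<in> valuation_ideal (adjoin \<iota> a) ext_val"
      using adj.L.add_mem[OF adj.\<iota>_mem x(3)] by (simp add: valuation_ideal_def)
    moreover have "x = \<iota> c + (\<iota> \<mu> + m)" using x(1) by (simp add: \<iota>.hom_add)
    ultimately show "x \<in> ?R" by blast
  qed
  show "?R \<subseteq> ?L"
  proof -
    have "0 \<in> valuation_ideal UNIV v" by (simp add: valuation_ideal_def K.val_zero zero_vinf_def)
    then have "c \<in> (+) c ` valuation_ideal UNIV v" by force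
    then show ?thesis unfolding residue_embedding_def by blast
  qed
qed

lemma coset_eq:
  assumes "y \<in> adjoin \<iota> a" "z \<in> adjoin \<iota> a" "0 < ext_val (y - z)"
  shows "(+) y ` valuation_ideal (adjoin \<iota> a) ext_val \<subseteq> (+) z ` valuation_ideal (adjoin \<iota> a) ext_val"
proof
  fix x assume "x \<in> (+) y ` valuation_ideal (adjoin \<iota> a) ext_val"
  then obtain m where m: "x = y + m" "m \<in> adjoin \<iota> a" "0 < ext_val m"
    by (auto simp: valuation_ideal_def)
  have yz: "y - z \<in> adjoin \<iota> a" using assms adj.L.minus_mem by blast
  have "min (ext_val (y - z)) (ext_val m) \<le> ext_val (y - z + m)"
    using yz m(2) by (rule adj.L.val_add)
  then have "0 < ext_val (y - z + m)"
    using assms(3) m(3) by (auto simp: min_def split: if_splits)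
  then have "y - z + m \<in> valuation_ideal (adjoin \<iota> a) ext_val"
    using adj.L.add_mem[OF yz m(2)] by (simp add: valuation_ideal_def)
  moreover have "x = z + (y - z + m)" using m(1) by simp
  ultimately show "x \<in> (+) z ` valuation_ideal (adjoin \<iota> a) ext_val" by blast
qed

lemma residue_field_ext_val:
  "residue_embedding \<iota> (adjoin \<iota> a) ext_val ` residue_field UNIV v = residue_field (adjoin \<iota> a) ext_val"
proof
  show "residue_embedding \<iota> (adjoin \<iota> a) ext_val ` residue_field UNIV v \<subseteq> residue_field (adjoin \<iota> a) ext_val"
  proof
    fix C assume "C \<in> residue_embedding \<iota> (adjoin \<iota> a) ext_val ` residue_field UNIV v"
    then obtain c where "0 \<le> v c" "C = (+) (\<iota> c) ` valuation_ideal (adjoin \<iota> a) ext_val"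
      by (auto simp: residue_field_def valuation_ring_def residue_embedding_coset)
    moreover have "\<iota> c \<in> valuation_ring (adjoin \<iota> a) ext_val"
      using \<open>0 \<le> v c\<close> ext_val_\<iota> adj.\<iota>_mem by (simp add: valuation_ring_def)
    ultimately show "C \<in> residue_field (adjoin \<iota> a) ext_val" unfolding residue_field_def by blast
  qed
next
  show "residue_field (adjoin \<iota> a) ext_val \<subseteq> residue_embedding \<iota> (adjoin \<iota> a) ext_val ` residue_field UNIV v"
  proof
    fix C assume "C \<in> residue_field (adjoin \<iota> a) ext_val"
    then obtain y where y: "y \<in> adjoin \<iota> a" "0 \<le> ext_val y"
      and C: "C = (+) y ` valuation_ideal (adjoin \<iota> a) ext_val"
      by (auto simp: residue_field_def valuation_ring_def)
    obtain c where c: "0 < ext_val (y - \<iota> c)" using residue_approximable y by blast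
    have "min (ext_val y) (ext_val (y - \<iota> c)) \<le> ext_val (y - (y - \<iota> c))"
      by (intro adj.L.val_diff adj.L.minus_mem y adj.\<iota>_mem)
    then have "0 \<le> v c" using c y(2) ext_val_\<iota>[of c] by (auto simp: min_def split: if_splits)
    then have "(+) c ` valuation_ideal UNIV v \<in> residue_field UNIV v"
      by (auto simp: residue_field_def valuation_ring_def)
    moreover have "C = (+) (\<iota> c) ` valuation_ideal (adjoin \<iota> a) ext_val"
    proof -
      have "0 < ext_val (\<iota> c - y)"
        using c adj.L.val_minus_commute[OF adj.\<iota>_mem y(1)] by simp
      then show ?thesis
        unfolding C using coset_eq[OF y(1) adj.\<iota>_mem c] coset_eq[OF adj.\<iota>_mem y(1)] by blast
    qed
    ultimately show "C \<in> residue_embedding \<iota> (adjoin \<iota> a) ext_val ` residue_field UNIV v"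
      using residue_embedding_coset by blast
  qed
qed

lemma immediate_extension_ext_val: "immediate_extension v \<iota> id (adjoin \<iota> a) ext_val"
  using valued_extension_ext_val value_group_ext_val residue_field_ext_val
  by (simp add: immediate_extension_def)

end

section \<open>Uniqueness of the extension\<close>

context root_of_minimal_polynomial
begin

lemma field_iso_ev:
  assumes iso: "field_iso_on (adjoin \<iota> a) G \<sigma>" and over: "\<And>c. \<sigma> (\<iota> c) = \<iota>' c"
    and "field_hom \<iota>'"
  shows "\<sigma> (ev g) = eval_via \<iota>' g (\<sigma> a)"
proof -
  interpret \<iota>': field_hom \<iota>' by fact
  have \<sigma>: "\<sigma> (x + y) = \<sigma> x + \<sigma> y" "\<sigma> (x * y) = \<sigma> x * \<sigma> y"
    if "x \<in> adjoin \<iota> a" "y \<in> adjoin \<iota> a" for x y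
    using iso that by (auto simp: field_iso_on_def)
  show ?thesis
  proof (induction g)
    case 0
    show ?case using over[of 0] by simp
  next
    case (pCons c p)
    have "\<sigma> (\<iota> c + a * ev p) = \<sigma> (\<iota> c) + \<sigma> a * \<sigma> (ev p)"
      using \<sigma>(1)[OF adj.\<iota>_mem adj.L.mult_mem[OF a_mem ev_mem]] \<sigma>(2)[OF a_mem ev_mem] by simp
    then show ?case using pCons.IH over by (simp add: \<iota>.map_poly_pCons_hom \<iota>'.map_poly_pCons_hom)
  qed
qed

text \<open>Both \<open>w(g(a))\<close> and \<open>w'(g(b))\<close> are images of the eventual value of \<open>g\<close> along \<open>A\<close>, under \<open>\<phi>\<close> and \<open>\<phi>'\<close>.
  The isomorphism of value groups is therefore \<open>\<phi>' \<circ> \<phi>\<^sup>-\<^sup>1\<close> on the image of the value group of \<open>v\<close>.\<close>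

lemma equivalent_of_appr_eq:
  fixes w :: "'l \<Rightarrow> 'h::linordered_ab_group_add vinf"
    and \<iota>' :: "'k \<Rightarrow> 'm::field" and w' :: "'m \<Rightarrow> 'i::linordered_ab_group_add vinf"
  assumes ext: "valued_extension v \<iota> \<phi> (adjoin \<iota> a) w" and appr: "appr v \<iota> \<phi> w a = A"
    and ext': "valued_extension v \<iota>' \<phi>' (adjoin \<iota>' b) w'" and appr': "appr v \<iota>' \<phi>' w' b = A"
    and iso: "field_iso_on (adjoin \<iota> a) (adjoin \<iota>' b) \<sigma>"
    and over: "\<And>c. \<sigma> (\<iota> c) = \<iota>' c" and \<sigma>a: "\<sigma> a = b"
  shows "equivalent_valuations (adjoin \<iota> a) w (w' \<circ> \<sigma>)"
proof -
  let ?F = "adjoin \<iota> a" and ?G = "value_group UNIV v"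
  interpret E: extension_of_approximation v A \<iota> \<phi> ?F w by unfold_locales (rule ext)
  interpret E': extension_of_approximation v A \<iota>' \<phi>' "adjoin \<iota>' b" w' by unfold_locales (rule ext')
  have b_mem: "b \<in> adjoin \<iota>' b" by (simp add: adjoin_def)
  have common_value: "\<exists>\<alpha>\<in>insert Infty (Fin ` ?G). w x = map_vinf \<phi> \<alpha> \<and> w' (\<sigma> x) = map_vinf \<phi>' \<alpha>"
    if x: "x \<in> ?F" for x
  proof -
    obtain g where g: "degree g < degree f" "x = ev g" using adjoin_cases[OF x] by blast
    have fixed: "fixes_value v A h" if "degree h \<le> degree g" for h
      using that g(1) by (intro fixes_small) simp
    have "\<sigma> x = eval_via \<iota>' g b"
      using field_iso_ev[OF iso over] ext' g(2) \<sigma>a by (simp add: valued_extension_def)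
    then have "w' (\<sigma> x) = map_vinf \<phi>' (eventual_value v A g)"
      using E'.val_eval_via[OF b_mem E'.dist_of_appr_eq[OF appr' b_mem] fixed] by simp
    moreover have "w x = map_vinf \<phi> (eventual_value v A g)"
      using E.val_eval_via[OF a_mem E.dist_of_appr_eq[OF appr a_mem] fixed] g(2) by simp
    moreover have "eventual_value v A g \<in> insert Infty (Fin ` ?G)"
    proof -
      obtain c where "v (poly g c) = eventual_value v A g"
        using eventual_value_attained[OF fixes_small[OF g(1)]] by blast
      then show ?thesis by (cases "eventual_value v A g") (auto simp: value_group_def)
    qed
    ultimately show ?thesis by blast
  qed
  have vg: "value_group ?F w = \<phi> ` ?G"
  proof
    show "value_group ?F w \<subseteq> \<phi> ` ?G"
    proof
      fix \<gamma> assume "\<gamma> \<in> value_group ?F w"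
      then obtain x where "x \<in> ?F" "w x = Fin \<gamma>" by (auto simp: value_group_def)
      then show "\<gamma> \<in> \<phi> ` ?G" using common_value[of x] by auto
    qed
    show "\<phi> ` ?G \<subseteq> value_group ?F w"
    proof
      fix \<gamma> assume "\<gamma> \<in> \<phi> ` ?G"
      then obtain e c where "\<gamma> = \<phi> e" "v c = Fin e" by (auto simp: value_group_def)
      then have "w (\<iota> c) = Fin \<gamma>" by (simp add: E.w_\<iota>)
      then show "\<gamma> \<in> value_group ?F w" using E.\<iota>_mem unfolding value_group_def by blast
    qed
  qed
  have vg': "value_group ?F (w' \<circ> \<sigma>) = \<phi>' ` ?G"
  proof
    show "value_group ?F (w' \<circ> \<sigma>) \<subseteq> \<phi>' ` ?G"
    proof
      fix \<gamma> assume "\<gamma> \<in> value_group ?F (w' \<circ> \<sigma>)"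
      then obtain x where "x \<in> ?F" "w' (\<sigma> x) = Fin \<gamma>" by (auto simp: value_group_def)
      then show "\<gamma> \<in> \<phi>' ` ?G" using common_value[of x] by auto
    qed
    show "\<phi>' ` ?G \<subseteq> value_group ?F (w' \<circ> \<sigma>)"
    proof
      fix \<gamma> assume "\<gamma> \<in> \<phi>' ` ?G"
      then obtain e c where "\<gamma> = \<phi>' e" "v c = Fin e" by (auto simp: value_group_def)
      then have "w' (\<sigma> (\<iota> c)) = Fin \<gamma>" by (simp add: E'.w_\<iota> over)
      then show "\<gamma> \<in> value_group ?F (w' \<circ> \<sigma>)" using E.\<iota>_mem unfolding value_group_def by auto
    qed
  qed
  have inj: "inj_on \<phi> ?G" using E.\<phi>_strict_mono by (rule strict_mono_on_imp_inj_on)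
  define \<rho> where "\<rho> = \<phi>' \<circ> the_inv_into ?G \<phi>"
  have \<rho>: "\<rho> (\<phi> \<gamma>) = \<phi>' \<gamma>" if "\<gamma> \<in> ?G" for \<gamma>
    using that by (simp add: \<rho>_def the_inv_into_f_f[OF inj])
  have mono: "strict_mono_on (\<phi> ` ?G) \<rho>"
    using strict_mono_on_less[OF E.\<phi>_strict_mono] strict_mono_on_less[OF E'.\<phi>_strict_mono] \<rho>
    by (auto intro!: strict_mono_onI)
  have "bij_betw \<rho> (\<phi> ` ?G) (\<phi>' ` ?G)"
    unfolding bij_betw_def using strict_mono_on_imp_inj_on[OF mono] \<rho> by (auto simp: image_image)
  moreover have "\<rho> (\<phi> \<gamma> + \<phi> \<delta>) = \<rho> (\<phi> \<gamma>) + \<rho> (\<phi> \<delta>)" if "\<gamma> \<in> ?G" "\<delta> \<in> ?G" for \<gamma> \<delta>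
  proof -
    obtain c d where "v c = Fin \<gamma>" "v d = Fin \<delta>" using \<open>\<gamma> \<in> ?G\<close> \<open>\<delta> \<in> ?G\<close> by (auto simp: value_group_def)
    then have "v (c * d) = Fin (\<gamma> + \<delta>)" by (simp add: K.val_mult)
    then have "\<gamma> + \<delta> \<in> ?G" by (auto simp: value_group_def)
    then show ?thesis using \<open>\<gamma> \<in> ?G\<close> \<open>\<delta> \<in> ?G\<close> E.\<phi>_add E'.\<phi>_add \<rho> by metis
  qed
  moreover have "(w' \<circ> \<sigma>) x = map_vinf \<rho> (w x)" if "x \<in> ?F" for x
    using common_value[OF that] \<rho> by auto
  ultimately show ?thesis
    unfolding equivalent_valuations_def vg vg' using mono by (intro exI[of _ \<rho>]) auto
qed

end

theorem theorem3p16: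
  fixes v :: "'k::field \<Rightarrow> 'g::linordered_ab_group_add vinf"
    and A :: "('k, 'g) vball set"
    and f :: "'k poly"
    and \<iota> :: "'k \<Rightarrow> 'l::field"
    and a :: 'l
  assumes "valuation_on UNIV v"
    and "immediate_type v A"
    and "algebraic_type v A"
    and "associated_minimal_polynomial v A f"
    and "field_hom \<iota>"
    and "poly (map_poly \<iota> f) a = 0"
  shows "(\<exists>w :: 'l \<Rightarrow> 'g vinf.
            valued_extension v \<iota> id (adjoin \<iota> a) w \<and>
            immediate_extension v \<iota> id (adjoin \<iota> a) w \<and>
            appr v \<iota> id w a = A) \<and>
         (\<forall>(w :: 'l \<Rightarrow> 'h::linordered_ab_group_add vinf) \<phi>
           (\<iota>' :: 'k \<Rightarrow> 'm::field) b (w' :: 'm \<Rightarrow> 'i::linordered_ab_group_add vinf) \<phi>' \<sigma>.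
            valued_extension v \<iota> \<phi> (adjoin \<iota> a) w \<and>
            immediate_extension v \<iota> \<phi> (adjoin \<iota> a) w \<and>
            appr v \<iota> \<phi> w a = A \<and>
            valued_extension v \<iota>' \<phi>' (adjoin \<iota>' b) w' \<and>
            appr v \<iota>' \<phi>' w' b = A \<and>
            field_iso_on (adjoin \<iota> a) (adjoin \<iota>' b) \<sigma> \<and>
            (\<forall>c. \<sigma> (\<iota> c) = \<iota>' c) \<and> \<sigma> a = b \<longrightarrow>
            equivalent_valuations (adjoin \<iota> a) w (w' \<circ> \<sigma>))"
proof -
  interpret root_of_minimal_polynomial v A f \<iota> a
    by (intro root_of_minimal_polynomial.intro algebraic_approximation.intro immediate_approximation.intro
        algebraic_approximation_axioms.intro root_of_minimal_polynomial_axioms.intro) (fact assms)+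
  show ?thesis
  proof (intro conjI allI impI)
    show "\<exists>w :: 'l \<Rightarrow> 'g vinf. valued_extension v \<iota> id (adjoin \<iota> a) w \<and>
        immediate_extension v \<iota> id (adjoin \<iota> a) w \<and> appr v \<iota> id w a = A"
      using valued_extension_ext_val immediate_extension_ext_val appr_ext_val by blast
  qed (elim conjE, rule equivalent_of_appr_eq, auto)
qed

end
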